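(* Let $M$ be a split matroid of rank $r$ and let $(A_1,A_2)$ and $(B_1,B_2)$ be compatible pairs of bases of $M$, that is, $A_1\cap A_2=B_1\cap B_2$ and $A_1\cup A_2=B_1\cup B_2$. Then the exchange distance of $(A_1,A_2)$ and $(B_1,B_2)$ is at most $\min\{r,\ r-|A_1\cap B_1|+1\}$.
   Context: All matroids are on finite ground sets. For a set $X$ and elements $e,f$, write $X-e=X\setminus\{e\}$ and $X+f=X\cup\{f\}$; $X-Y$ denotes set difference. Symmetric exchange: let $(X_1,X_2)$ be an ordered pair of bases of a matroid $M$. If $e\in X_1-X_2$ and $f\in X_2-X_1$ are such that both $X_1-e+f$ and $X_2+e-f$ are bases of $M$, then the pair $(X_1-e+f,\,X_2+e-f)$ is said to be obtained from $(X_1,X_2)$ by a symmetric exchange. The exchange distance of two basis pairs is the minimum number of successive symmetric exchanges needed to transform the first pair into the second, and $+\infty$ if no such sequence exists. Elementary split matroid: let $S$ be a finite set, $r,r_1,\dots,r_q$ ($q\ge 0$) non-negative integers with $|S|\ge r$, and $H_1,\dots,H_q\subseteq S$ subsets such that $|H_i\cap H_j|\le r_i+r_j-r$ for all $1\le i<j\le q$, and $|S-H_i|+r_i\ge r$ for all $i$. Then $\{X\subseteq S : |X|\le r,\ |X\cap H_i|\le r_i \text{ for } 1\le i\le q\}$ is the family of independent sets of a rank-$r$ matroid on $S$; matroids arising this way are called elementary split matroids. Split matroid: a matroid is a split matroid if at most one of its connected components is a non-uniform matroid, and this component, if it exists, is an elementary split matroid (all other components being uniform matroids). *)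

theory Defs
  imports Main "HOL-Library.Extended_Nat"
begin

locale matroid =
  fixes S :: "'a set" and indep :: "'a set \<Rightarrow> bool"
  assumes finite_ground: "finite S"
    and indep_subset_ground: "indep X \<Longrightarrow> X \<subseteq> S"
    and indep_empty: "indep {}"
    and indep_subset: "indep X \<Longrightarrow> Y \<subseteq> X \<Longrightarrow> indep Y"
    and augmentation:
      "indep X \<Longrightarrow> indep Y \<Longrightarrow> card X < card Y \<Longrightarrow> \<exists>e\<in>Y - X. indep (insert e X)"

definition is_basis :: "('a set \<Rightarrow> bool) \<Rightarrow> 'a set \<Rightarrow> bool" where
  "is_basis indep B \<longleftrightarrow> indep B \<and> (\<forall>X. indep X \<longrightarrow> B \<subseteq> X \<longrightarrow> X = B)"

definition matroid_rank :: "('a set \<Rightarrow> bool) \<Rightarrow> nat" where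
  "matroid_rank indep = Max (card ` {X. indep X})"

definition restrict_indep :: "('a set \<Rightarrow> bool) \<Rightarrow> 'a set \<Rightarrow> 'a set \<Rightarrow> bool" where
  "restrict_indep indep C = (\<lambda>X. X \<subseteq> C \<and> indep X)"

text \<open>The direct sum is only meaningful for disjoint ground sets.\<close>

definition direct_sum_indep ::
    "'a set \<Rightarrow> ('a set \<Rightarrow> bool) \<Rightarrow> 'a set \<Rightarrow> ('a set \<Rightarrow> bool) \<Rightarrow> 'a set \<Rightarrow> bool" where
  "direct_sum_indep S1 indep1 S2 indep2 =
     (\<lambda>X. X \<subseteq> S1 \<union> S2 \<and> indep1 (X \<inter> S1) \<and> indep2 (X \<inter> S2))"

definition connected_matroid :: "'a set \<Rightarrow> ('a set \<Rightarrow> bool) \<Rightarrow> bool" where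
  "connected_matroid S indep \<longleftrightarrow>
     \<not> (\<exists>S1 indep1 S2 indep2. matroid S1 indep1 \<and> matroid S2 indep2 \<and>
          S1 \<noteq> {} \<and> S2 \<noteq> {} \<and> S1 \<inter> S2 = {} \<and> S1 \<union> S2 = S \<and>
          indep = direct_sum_indep S1 indep1 S2 indep2)"

text \<open>
  A component is identified with its ground set \<open>C\<close>; as a matroid it is the restriction to \<open>C\<close>.
  The components are the nonempty connected direct summands.
\<close>

definition is_component :: "'a set \<Rightarrow> ('a set \<Rightarrow> bool) \<Rightarrow> 'a set \<Rightarrow> bool" where
  "is_component S indep C \<longleftrightarrow>
     C \<subseteq> S \<and> C \<noteq> {} \<and>
     indep = direct_sum_indep C (restrict_indep indep C) (S - C) (restrict_indep indep (S - C)) \<and>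
     connected_matroid C (restrict_indep indep C)"

definition uniform_matroid :: "'a set \<Rightarrow> ('a set \<Rightarrow> bool) \<Rightarrow> bool" where
  "uniform_matroid S indep \<longleftrightarrow>
     (\<exists>r\<le>card S. \<forall>X. indep X \<longleftrightarrow> X \<subseteq> S \<and> card X \<le> r)"

definition elementary_split_matroid :: "'a set \<Rightarrow> ('a set \<Rightarrow> bool) \<Rightarrow> bool" where
  "elementary_split_matroid S indep \<longleftrightarrow>
     finite S \<and>
     (\<exists>(r::nat) (q::nat) (H :: nat \<Rightarrow> 'a set) (h :: nat \<Rightarrow> nat).
        card S \<ge> r \<and>
        (\<forall>i<q. H i \<subseteq> S) \<and>
        (\<forall>i j. i < j \<longrightarrow> j < q \<longrightarrow>
           int (card (H i \<inter> H j)) \<le> int (h i) + int (h j) - int r) \<and>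
        (\<forall>i<q. card (S - H i) + h i \<ge> r) \<and>
        (\<forall>X. indep X \<longleftrightarrow> X \<subseteq> S \<and> card X \<le> r \<and> (\<forall>i<q. card (X \<inter> H i) \<le> h i)))"

definition split_matroid :: "'a set \<Rightarrow> ('a set \<Rightarrow> bool) \<Rightarrow> bool" where
  "split_matroid S indep \<longleftrightarrow>
     matroid S indep \<and>
     (\<exists>\<^sub>\<le>\<^sub>1 C. is_component S indep C \<and> \<not> uniform_matroid C (restrict_indep indep C)) \<and>
     (\<forall>C. is_component S indep C \<longrightarrow> \<not> uniform_matroid C (restrict_indep indep C) \<longrightarrow>
        elementary_split_matroid C (restrict_indep indep C))"

definition symmetric_exchange ::
    "('a set \<Rightarrow> bool) \<Rightarrow> (('a set \<times> 'a set) \<times> ('a set \<times> 'a set)) set" where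
  "symmetric_exchange indep =
     {((X1, X2), (insert f (X1 - {e}), insert e X2 - {f})) | X1 X2 e f.
        is_basis indep X1 \<and> is_basis indep X2 \<and> e \<in> X1 - X2 \<and> f \<in> X2 - X1 \<and>
        is_basis indep (insert f (X1 - {e})) \<and> is_basis indep (insert e X2 - {f})}"

text \<open>The infimum of the empty set in \<^typ>\<open>enat\<close> is \<open>\<infinity>\<close>.\<close>

definition exchange_distance ::
    "('a set \<Rightarrow> bool) \<Rightarrow> 'a set \<times> 'a set \<Rightarrow> 'a set \<times> 'a set \<Rightarrow> enat" where
  "exchange_distance indep P Q = Inf (enat ` {n. (P, Q) \<in> symmetric_exchange indep ^^ n})"

definition compatible_pairs :: "'a set \<times> 'a set \<Rightarrow> 'a set \<times> 'a set \<Rightarrow> bool" where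
  "compatible_pairs P Q \<longleftrightarrow>
     fst P \<inter> snd P = fst Q \<inter> snd Q \<and> fst P \<union> snd P = fst Q \<union> snd Q"

end

theory Submission
  imports Defs
begin

text \<open>
  At least \<open>card (A1 - B1)\<close> exchanges are needed, because each one brings a single element of
  \<open>B1\<close> into the first basis. The proof shows that one additional exchange always suffices, and that
  none is necessary when \<open>A1\<close> and \<open>B1\<close> are disjoint; as \<open>card (A1 - B1)\<close> equals
  \<open>r - card (A1 \<inter> B1)\<close>, this gives both terms of the minimum.

  For an elementary split matroid, fix \<open>U = A1 \<union> A2\<close> and \<open>D = A1 \<inter> A2\<close>. Then a pair is determined by
  its first member \<open>X\<close>, the second one being \<open>co X = (U - X) \<union> D\<close>. The overlap condition on the
  hyperedges \<open>H i\<close> has two consequences. An \<open>r\<close>-set that meets one \<open>H i\<close> in exactly \<open>h i\<close> elements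
  (is \<^emph>\<open>tight\<close> there) satisfies all the other constraints (\<open>tight_imp_base\<close>), so that feasibility along
  a path follows from watching few hyperedges. An \<open>r\<close>-set that is tight at two hyperedges lies
  between their intersection and their union (\<open>two_tight\<close>).

  When no exchange brings \<open>A\<close> closer to \<open>B\<close>, every pair in \<open>(A - B) \<times> (B - A)\<close> is blocked by a
  hyperedge tight for \<open>A\<close> or by one tight for \<open>co A\<close>. For each of the two sides the blocked pairs
  form vertex-disjoint complete bipartite graphs, and two such families cover a complete bipartite
  graph only in very few ways. Counting excludes all but one (\<open>monotone_step_or_obstructed\<close>):
  two hyperedges \<open>H i\<close>, \<open>H i'\<close> are tight for \<open>A\<close> and \<open>B\<close>, two others \<open>H j\<close>, \<open>H j'\<close> are tight for
  \<open>co A\<close> and \<open>co B\<close>, and all four separate elements of \<open>A - B\<close> and of \<open>B - A\<close>. This configuration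
  is called an obstruction.

  One unit of slack at one of the four hyperedges is enough to get through an obstruction. For
  example, let \<open>H i\<close> have slack one while \<open>H i'\<close> is tight for the first member and \<open>H j\<close> is tight for
  the second. Elements from \<open>H i\<close> and from \<open>H i'\<close> can then be exchanged so that the slack
  moves back and forth between \<open>i\<close> and \<open>i'\<close>, and no step is lost (\<open>corridor_path\<close>). Hence there are
  two ways to deal with an obstruction. If a monotone path runs into one that was not there before, its
  last step moved an element that provides slack, and it can be rerouted without a loss
  (\<open>monotone_path_or_obstructed\<close>). If the obstruction is there from the start, the overlap condition
  yields an element outside \<open>D\<close> in \<open>H i \<inter> H i'\<close> or \<open>H j \<inter> H j'\<close>. Moving it out and back gives the
  slack at the cost of one exchange (\<open>feasible_distance\<close>). Such an element lies in \<open>A \<inter> B\<close> or in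
  \<open>co A \<inter> co B\<close>, which is why disjoint \<open>A\<close> and \<open>B\<close> are never obstructed.

  For uniform matroids there are no hyperedges and hence no obstructions. In a direct sum the exchange
  sequences of the summands are carried out one after the other, so the additional exchange is
  needed at most once, in the only non-uniform component.
\<close>

section \<open>Counting elements in exchanges\<close>

lemma card_swap_Int:
  assumes "finite X" "e \<in> X" "f \<notin> X"
  shows "card (insert f (X - {e}) \<inter> K) + of_bool (e \<in> K) = card (X \<inter> K) + of_bool (f \<in> K)"
proof -
  have K: "card ((X - {e}) \<inter> K) + of_bool (e \<in> K) = card (X \<inter> K)"
  proof (cases "e \<in> K")
    case True
    then have "(X - {e}) \<inter> K = X \<inter> K - {e}" "e \<in> X \<inter> K" using assms by auto
    then show ?thesis using True assms(1) card.remove[of "X \<inter> K" e] by simp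
  next
    case False
    then have "(X - {e}) \<inter> K = X \<inter> K" by auto
    then show ?thesis using False by simp
  qed
  have "card (insert f (X - {e}) \<inter> K) = card ((X - {e}) \<inter> K) + of_bool (f \<in> K)"
    using assms by (cases "f \<in> K") (auto simp: Int_insert_left)
  with K show ?thesis by simp
qed

text \<open>
  Both sides count \<open>(A \<union> B) \<inter> K\<close>. For \<open>A\<close> and \<open>B\<close> with the same number of elements in \<open>K\<close>, the two
  difference sets therefore also agree in that number.
\<close>

lemma card_Int_balance:
  assumes "finite A" "finite B"
  shows "card (A \<inter> K) + card ((B - A) \<inter> K) = card (B \<inter> K) + card ((A - B) \<inter> K)"
proof -
  have "card (A \<inter> K) + card ((B - A) \<inter> K) = card (A \<inter> K \<union> (B - A) \<inter> K)"
    by (rule card_Un_disjoint[symmetric]) (use assms in auto)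
  also have "A \<inter> K \<union> (B - A) \<inter> K = B \<inter> K \<union> (A - B) \<inter> K" by auto
  also have "card \<dots> = card (B \<inter> K) + card ((A - B) \<inter> K)"
    by (rule card_Un_disjoint) (use assms in auto)
  finally show ?thesis .
qed

lemma card_Diff_swap:
  assumes "finite A" "finite B" "card A = card B"
  shows "card (A - B) = card (B - A)"
  using card_Int_balance[of A B UNIV] assms by simp

text \<open>
  This finds partners for exchanges that leave the number of elements in \<open>K\<close> unchanged.
\<close>

lemma equal_trace_partner:
  assumes "finite P" "finite Q" "card P = card Q" "card (P \<inter> K) = card (Q \<inter> K)" "p \<in> P"
  shows "\<exists>q\<in>Q. q \<in> K \<longleftrightarrow> p \<in> K"
proof (cases "p \<in> K")
  case True
  then have "card (P \<inter> K) > 0" using assms by (auto simp: card_gt_0_iff)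
  then have "Q \<inter> K \<noteq> {}" using assms by auto
  then show ?thesis using True by auto
next
  case False
  have "card (P - K) = card (Q - K)"
    using assms by (metis card_Diff_subset_Int finite_Int)
  moreover have "card (P - K) > 0" using assms False by (auto simp: card_gt_0_iff)
  ultimately have "Q - K \<noteq> {}" by (metis card.empty less_numeral_extra(3))
  then show ?thesis using False by auto
qed

section \<open>Tight constraints in elementary split matroids\<close>

locale split_system =
  fixes S :: "'a set" and r :: nat and I :: "'i set" and H :: "'i \<Rightarrow> 'a set" and h :: "'i \<Rightarrow> nat"
  assumes finite_S: "finite S"
    and H_subset: "i \<in> I \<Longrightarrow> H i \<subseteq> S"
    and overlap: "i \<in> I \<Longrightarrow> j \<in> I \<Longrightarrow> i \<noteq> j \<Longrightarrow> card (H i \<inter> H j) + r \<le> h i + h j"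
begin

definition base :: "'a set \<Rightarrow> bool" where
  "base X \<longleftrightarrow> X \<subseteq> S \<and> card X = r \<and> (\<forall>i\<in>I. card (X \<inter> H i) \<le> h i)"

definition tight :: "'a set \<Rightarrow> 'i \<Rightarrow> bool" where
  "tight X i \<longleftrightarrow> i \<in> I \<and> card (X \<inter> H i) = h i"

lemma finite_H: "i \<in> I \<Longrightarrow> finite (H i)"
  using H_subset finite_S finite_subset by blast

text \<open>
  If \<open>X\<close> has \<open>h i\<close> elements in \<open>H i\<close> and more than \<open>h t\<close> in \<open>H t\<close>, then counting elements of \<open>H i \<inter> H t\<close>
  twice gives more than \<open>h i + h t - card (H i \<inter> H t)\<close>, hence more than \<open>r\<close>, elements of \<open>X\<close>.
\<close>

lemma tight_imp_base:
  assumes "X \<subseteq> S" "card X = r" "tight X i"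
  shows "base X"
  unfolding base_def
proof (intro conjI ballI)
  fix t assume t: "t \<in> I"
  have i: "i \<in> I" "card (X \<inter> H i) = h i" using assms(3) by (auto simp: tight_def)
  have fX: "finite X" using assms(1) finite_S finite_subset by blast
  show "card (X \<inter> H t) \<le> h t"
  proof (cases "t = i")
    case False
    have "card (X \<inter> H i) + card (X \<inter> H t)
        = card (X \<inter> H i \<union> X \<inter> H t) + card (X \<inter> H i \<inter> (X \<inter> H t))"
      by (rule card_Un_Int) (use fX in auto)
    also have "\<dots> \<le> card X + card (H i \<inter> H t)"
      by (intro add_mono card_mono) (use fX finite_H[OF i(1)] in auto)
    finally show ?thesis using overlap[OF i(1) t] False i(2) assms(2) by simp
  qed (use i in simp)
qed (use assms in auto)

text \<open>
  Equality must hold throughout the estimate \<open>h i + h i' \<le> card X + card (H i \<inter> H i')\<close>.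
\<close>

lemma two_tight:
  assumes "X \<subseteq> S" "card X = r" "tight X i" "tight X i'" "i \<noteq> i'"
  shows two_tight_cover: "X \<subseteq> H i \<union> H i'" and two_tight_core: "H i \<inter> H i' \<subseteq> X"
    and two_tight_card: "card (H i \<inter> H i') + r = h i + h i'"
proof -
  have i: "i \<in> I" "card (X \<inter> H i) = h i" "i' \<in> I" "card (X \<inter> H i') = h i'"
    using assms(3,4) by (auto simp: tight_def)
  have fX: "finite X" using assms(1) finite_S finite_subset by blast
  have fH: "finite (H i \<inter> H i')" using finite_H[OF i(1)] by simp
  have eq: "h i + h i' = card (X \<inter> (H i \<union> H i')) + card (X \<inter> (H i \<inter> H i'))"
    using card_Un_Int[of "X \<inter> H i" "X \<inter> H i'"] fX i
    by (simp add: Int_Un_distrib Int_ac)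
  have le1: "card (X \<inter> (H i \<union> H i')) \<le> card X" using fX by (intro card_mono) auto
  have le2: "card (X \<inter> (H i \<inter> H i')) \<le> card (H i \<inter> H i')" using fH by (intro card_mono) auto
  note ov = overlap[OF i(1,3) assms(5)]
  have "X \<inter> (H i \<union> H i') = X"
    by (rule card_subset_eq) (use fX eq le1 le2 ov assms(2) in auto)
  then show "X \<subseteq> H i \<union> H i'" by auto
  have "X \<inter> (H i \<inter> H i') = H i \<inter> H i'"
    by (rule card_subset_eq[OF fH]) (use eq le1 le2 ov assms(2) in auto)
  then show "H i \<inter> H i' \<subseteq> X" by auto
  show "card (H i \<inter> H i') + r = h i + h i'" using eq le1 le2 ov assms(2) by linarith
qed

end

section \<open>Pairs with prescribed union and intersection\<close>

locale split_pair = split_system S r I H h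
  for S :: "'a set" and r :: nat and I :: "'i set" and H :: "'i \<Rightarrow> 'a set" and h :: "'i \<Rightarrow> nat" +
  fixes U D :: "'a set"
  assumes D_U: "D \<subseteq> U" and U_S: "U \<subseteq> S" and card_UD: "card U + card D = 2 * r"
begin

text \<open>
  The first members of the pairs with union \<open>U\<close> and intersection \<open>D\<close> are the sets in \<open>mid\<close>, and
  \<open>co\<close> recovers the second member. It is an involution that exchanges the roles of the two members,
  so every statement about the first member also yields one about the second.
\<close>

definition mid :: "'a set \<Rightarrow> bool" where
  "mid X \<longleftrightarrow> D \<subseteq> X \<and> X \<subseteq> U \<and> card X = r"

definition co :: "'a set \<Rightarrow> 'a set" where
  "co X = (U - X) \<union> D"

definition feasible :: "'a set \<Rightarrow> bool" where
  "feasible X \<longleftrightarrow> mid X \<and> base X \<and> base (co X)"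

text \<open>
  A symmetric exchange, read off from the first members alone.
\<close>

definition adjacent :: "('a set \<times> 'a set) set" where
  "adjacent = {(X, Y). feasible X \<and> feasible Y \<and> card (X - Y) = 1}"

lemma finite_U: "finite U" using U_S finite_S finite_subset by blast

lemma mid_finite: "mid X \<Longrightarrow> finite X"
  using finite_U finite_subset by (auto simp: mid_def)

lemma mid_S: "mid X \<Longrightarrow> X \<subseteq> S" using U_S by (auto simp: mid_def)

lemma mid_card: "mid X \<Longrightarrow> card X = r" by (simp add: mid_def)

lemma co_co: "mid X \<Longrightarrow> co (co X) = X"
  using D_U by (auto simp: co_def mid_def)

lemma card_co_Int:
  assumes "mid X"
  shows "card (co X \<inter> K) + card (X \<inter> K) = card (U \<inter> K) + card (D \<inter> K)"
proof -
  have "card (co X \<inter> K) + card (X \<inter> K)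
      = card ((co X \<inter> K) \<union> (X \<inter> K)) + card ((co X \<inter> K) \<inter> (X \<inter> K))"
    by (rule card_Un_Int) (use mid_finite[OF assms] finite_U D_U finite_subset in \<open>auto simp: co_def\<close>)
  moreover have "(co X \<inter> K) \<union> (X \<inter> K) = U \<inter> K" "(co X \<inter> K) \<inter> (X \<inter> K) = D \<inter> K"
    using assms D_U by (auto simp: co_def mid_def)
  ultimately show ?thesis by simp
qed

lemma mid_co: "mid X \<Longrightarrow> mid (co X)"
  using card_co_Int[of X UNIV] card_UD D_U by (auto simp: mid_def co_def)

lemma co_Diff: "mid X \<Longrightarrow> mid Y \<Longrightarrow> co X - co Y = Y - X"
  by (auto simp: co_def mid_def)

lemma mid_swap:
  assumes "mid X" "e \<in> X" "e \<notin> D" "f \<in> U" "f \<notin> X"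
  shows "mid (insert f (X - {e}))"
  using assms card_swap_Int[OF mid_finite[OF assms(1)] assms(2,5), of UNIV]
  by (auto simp: mid_def)

lemma co_swap:
  assumes "mid X" "e \<in> X" "e \<notin> D" "f \<in> U" "f \<notin> X"
  shows "co (insert f (X - {e})) = insert e (co X - {f})"
  using assms by (auto simp: co_def mid_def)

lemma feasible_mid: "feasible X \<Longrightarrow> mid X" by (simp add: feasible_def)

lemma feasible_co: "feasible X \<Longrightarrow> feasible (co X)"
  by (simp add: feasible_def mid_co co_co)

lemma feasibleI_tight: "mid X \<Longrightarrow> tight X i \<Longrightarrow> tight (co X) j \<Longrightarrow> feasible X"
  unfolding feasible_def by (metis tight_imp_base mid_co mid_S mid_card)

lemma feasible_le:
  assumes "feasible X" "i \<in> I"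
  shows "card (X \<inter> H i) \<le> h i" "card (co X \<inter> H i) \<le> h i"
  using assms by (auto simp: feasible_def base_def)

lemma mid_Diff_card: "mid X \<Longrightarrow> mid Y \<Longrightarrow> card (X - Y) = card (Y - X)"
  by (rule card_Diff_swap) (auto simp: mid_finite mid_card)

text \<open>
  Since \<open>card (X \<inter> K) + card (co X \<inter> K)\<close> is the same for all pairs, tightness of the second member
  can be followed by counting in the first one.
\<close>

lemma tight_co_iff:
  assumes "mid X" "mid Y"  "tight (co X) j"
  shows "tight (co Y) j \<longleftrightarrow> card (Y \<inter> H j) = card (X \<inter> H j)"
  using card_co_Int[OF assms(1), of "H j"] card_co_Int[OF assms(2), of "H j"] assms(3)
  by (auto simp: tight_def)

lemma adjacentI: "feasible X \<Longrightarrow> feasible Y \<Longrightarrow> X - Y = {x} \<Longrightarrow> (X, Y) \<in> adjacent"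
  by (simp add: adjacent_def)

lemma path_co:
  assumes "(X, Y) \<in> adjacent ^^ n"
  shows "(co X, co Y) \<in> adjacent ^^ n"
  using assms
proof (induction n arbitrary: Y)
  case (Suc n)
  then obtain Z where Z: "(X, Z) \<in> adjacent ^^ n" "(Z, Y) \<in> adjacent"
    by (auto elim: relpow_Suc_E)
  have "(co Z, co Y) \<in> adjacent"
    using Z(2) feasible_co mid_Diff_card[of Z Y] by (simp add: adjacent_def feasible_mid co_Diff)
  with Suc.IH[OF Z(1)] show ?case by (rule relpow_Suc_I)
qed simp

section \<open>Corridors of single slack\<close>

text \<open>
  Tightness at \<open>i\<close> or at \<open>i'\<close> makes the first member a basis, and tightness at \<open>j\<close> does the same for
  the second, so all sets in a corridor are feasible.
\<close>

definition corridor :: "'i \<Rightarrow> 'i \<Rightarrow> 'i \<Rightarrow> 'a set \<Rightarrow> bool" where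
  "corridor i i' j X \<longleftrightarrow> mid X \<and> i \<in> I \<and> i' \<in> I \<and> tight (co X) j \<and>
     (card (X \<inter> H i) = h i \<and> card (X \<inter> H i') + 1 = h i' \<or>
      card (X \<inter> H i) + 1 = h i \<and> card (X \<inter> H i') = h i')"

lemma corridor_sym: "corridor i i' j X \<longleftrightarrow> corridor i' i j X"
  unfolding corridor_def by blast

lemma corridor_feasible: "corridor i i' j X \<Longrightarrow> feasible X"
  using feasibleI_tight[of X i j] feasibleI_tight[of X i' j] by (auto simp: corridor_def tight_def)

text \<open>
  Here \<open>X\<close> is tight at \<open>i\<close> and has slack one at \<open>i'\<close>. If possible, \<open>p\<close> is taken from \<open>H i\<close>. A partner
  \<open>q\<close> in \<open>H i\<close> changes nothing, and a partner in \<open>H i'\<close> moves the slack from \<open>i'\<close> to \<open>i\<close>. If no element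
  of \<open>X - Y\<close> lies in \<open>H i\<close>, then by counting no element of \<open>Y - X\<close> does, and all of them lie in
  \<open>H i'\<close>. In each case \<open>q\<close> can be chosen on the same side of \<open>H j\<close> as \<open>p\<close>, which preserves tightness
  of the second member.
\<close>

lemma corridor_step_aux:
  assumes X: "corridor i i' j X" and Y: "corridor i i' j Y" and "X \<noteq> Y"
    and ex: "\<And>x. x \<in> (X - Y) \<union> (Y - X) \<Longrightarrow> x \<in> H i \<longleftrightarrow> x \<notin> H i'"
    and t: "card (X \<inter> H i) = h i"
  shows "\<exists>p\<in>X - Y. \<exists>q\<in>Y - X. corridor i i' j (insert q (X - {p}))"
proof -
  have mX: "mid X" and mY: "mid Y" using X Y by (auto simp: corridor_def)
  note fin = mid_finite[OF mX] mid_finite[OF mY]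
  have cPQ: "card (X - Y) = card (Y - X)" using mid_Diff_card[OF mX mY] .
  have cj: "card ((X - Y) \<inter> H j) = card ((Y - X) \<inter> H j)"
    using card_Int_balance[OF fin, of "H j"] tight_co_iff[OF mX mY, of j] X Y
    by (auto simp: corridor_def)
  have ci: "card ((Y - X) \<inter> H i) \<le> card ((X - Y) \<inter> H i)"
    using card_Int_balance[OF fin, of "H i"] X Y t by (auto simp: corridor_def)
  have ne: "X - Y \<noteq> {}"
    using \<open>X \<noteq> Y\<close> cPQ fin by (metis Diff_eq_empty_iff card_0_eq finite_Diff subset_antisym)
  obtain p where p: "p \<in> X - Y" "(X - Y) \<inter> H i \<noteq> {} \<Longrightarrow> p \<in> H i" using ne by blast
  obtain q where q: "q \<in> Y - X" "q \<in> H j \<longleftrightarrow> p \<in> H j"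
    using equal_trace_partner[OF _ _ cPQ cj p(1)] fin by auto
  let ?Z = "insert q (X - {p})"
  have pD: "p \<notin> D" "q \<in> U" using p q mY by (auto simp: mid_def)
  have mZ: "mid ?Z" using mid_swap[OF mX] p q pD by auto
  have sw: "card (?Z \<inter> K) + of_bool (p \<in> K) = card (X \<inter> K) + of_bool (q \<in> K)" for K
    using card_swap_Int[of X p q K] fin p q by auto
  have tj: "tight (co ?Z) j"
    using tight_co_iff[OF mX mZ, of j] sw[of "H j"] q(2) X by (auto simp: corridor_def)
  have pi: "q \<in> H i \<Longrightarrow> p \<in> H i"
  proof -
    assume "q \<in> H i"
    then have "card ((Y - X) \<inter> H i) > 0" using q fin by (auto simp: card_gt_0_iff)
    then have "(X - Y) \<inter> H i \<noteq> {}" using ci by auto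
    then show "p \<in> H i" by (rule p(2))
  qed
  have t': "card (X \<inter> H i') + 1 = h i'" using X t by (auto simp: corridor_def)
  have "corridor i i' j ?Z"
    using sw[of "H i"] sw[of "H i'"] ex[of p] ex[of q] p q pi t t' X mZ tj
    unfolding corridor_def by (auto split: if_splits simp: of_bool_def)
  then show ?thesis using p q by blast
qed

lemma corridor_step:
  assumes X: "corridor i i' j X" and Y: "corridor i i' j Y" and "X \<noteq> Y"
    and ex: "\<And>x. x \<in> (X - Y) \<union> (Y - X) \<Longrightarrow> x \<in> H i \<longleftrightarrow> x \<notin> H i'"
  shows "\<exists>p\<in>X - Y. \<exists>q\<in>Y - X. corridor i i' j (insert q (X - {p}))"
proof (cases "card (X \<inter> H i) = h i")
  case True
  then show ?thesis using corridor_step_aux[OF assms] by blast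
next
  case False
  then have "card (X \<inter> H i') = h i'" using X by (auto simp: corridor_def)
  then show ?thesis
    using corridor_step_aux[of i' i j X Y] assms unfolding corridor_sym[of i' i] by blast
qed

lemma corridor_path:
  assumes "corridor i i' j X" "corridor i i' j Y"
    and "\<And>x. x \<in> (X - Y) \<union> (Y - X) \<Longrightarrow> x \<in> H i \<longleftrightarrow> x \<notin> H i'"
  shows "(X, Y) \<in> adjacent ^^ card (X - Y)"
  using assms
proof (induction "card (X - Y)" arbitrary: X)
  case 0
  have mX: "mid X" and mY: "mid Y" using 0 by (auto simp: corridor_def)
  have "card (Y - X) = 0" using mid_Diff_card[OF mX mY] 0 by simp
  then have "X = Y" using 0 mid_finite[OF mX] mid_finite[OF mY] by auto
  then show ?case by simp
next
  case (Suc n)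
  have "X \<noteq> Y" using Suc(2) by auto
  from corridor_step[OF Suc.prems(1,2) this Suc.prems(3)] obtain p q where
    pq: "p \<in> X - Y" "q \<in> Y - X" "corridor i i' j (insert q (X - {p}))" by blast
  let ?Z = "insert q (X - {p})"
  have ZY: "?Z - Y = (X - Y) - {p}" using pq by auto
  have n: "n = card (?Z - Y)" unfolding ZY using Suc(2) pq(1) by simp
  have "(?Z, Y) \<in> adjacent ^^ n"
    using Suc.hyps(1)[OF n pq(3) Suc.prems(2)] Suc.prems(3) pq(1,2) n by auto
  moreover have "(X, ?Z) \<in> adjacent"
    using corridor_feasible[OF Suc.prems(1)] corridor_feasible[OF pq(3)] pq
    by (intro adjacentI[where x=p]) auto
  ultimately show ?case unfolding Suc(2)[symmetric] using relpow_Suc_I2 by metis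
qed

section \<open>Obstructions and detours\<close>

text \<open>
  \<open>K\<close> separates elements within each of the two difference sets.
\<close>

definition crossed :: "'a set \<Rightarrow> 'a set \<Rightarrow> 'a set \<Rightarrow> bool" where
  "crossed K A B \<longleftrightarrow> (A - B) \<inter> K \<noteq> {} \<and> (A - B) - K \<noteq> {} \<and> (B - A) \<inter> K \<noteq> {} \<and> (B - A) - K \<noteq> {}"

text \<open>
  The only configuration that can prevent a path of length \<open>card (A - B)\<close>. Membership in the two pairs
  of hyperedges splits the elements of \<open>A - B\<close> and \<open>B - A\<close> into four types. The condition does not fix
  the number of elements of each type, and so it passes from sets \<open>A\<close>, \<open>B\<close> to larger difference
  sets as long as the tightness persists.
\<close>

definition obstructed :: "'i \<Rightarrow> 'i \<Rightarrow> 'i \<Rightarrow> 'i \<Rightarrow> 'a set \<Rightarrow> 'a set \<Rightarrow> bool" where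
  "obstructed i i' j j' A B \<longleftrightarrow> mid A \<and> mid B \<and> i \<noteq> i' \<and> j \<noteq> j' \<and> {i, i'} \<inter> {j, j'} = {} \<and>
     (\<forall>t\<in>{i, i'}. tight A t \<and> tight B t \<and> crossed (H t) A B) \<and>
     (\<forall>t\<in>{j, j'}. tight (co A) t \<and> tight (co B) t \<and> crossed (H t) A B)"

lemma obstructed_flip: "obstructed i i' j j' A B \<Longrightarrow> obstructed i i' j' j A B"
  unfolding obstructed_def by blast

lemma obstructed_co: "obstructed i i' j j' A B \<Longrightarrow> obstructed j j' i i' (co A) (co B)"
  unfolding obstructed_def crossed_def by (simp add: mid_co co_co co_Diff)

lemma obstructedD:
  assumes "obstructed i i' j j' A B"
  shows "A \<subseteq> H i \<union> H i'" "B \<subseteq> H i \<union> H i'" "H i \<inter> H i' \<subseteq> A" "H i \<inter> H i' \<subseteq> B"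
    "card (H i \<inter> H i') + r = h i + h i'"
proof -
  have m: "mid A" "mid B" "i \<noteq> i'" "tight A i" "tight A i'" "tight B i" "tight B i'"
    using assms by (auto simp: obstructed_def)
  note A = two_tight[OF mid_S[OF m(1)] mid_card[OF m(1)] m(4,5,3)]
  note B = two_tight[OF mid_S[OF m(2)] mid_card[OF m(2)] m(6,7,3)]
  show "A \<subseteq> H i \<union> H i'" "B \<subseteq> H i \<union> H i'" "H i \<inter> H i' \<subseteq> A" "H i \<inter> H i' \<subseteq> B"
    "card (H i \<inter> H i') + r = h i + h i'" using A B by blast+
qed

text \<open>
  A set that is tight at both \<open>i\<close> and \<open>i'\<close> enters a corridor by an exchange that loses exactly one of
  the two tight constraints: an element of both hyperedges is replaced by an element of one, or an
  element of one by an element of neither.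
\<close>

lemma corridorI_swap:
  assumes Y: "mid Y" "tight Y i" "tight Y i'" "tight (co Y) j"
    and e: "e \<in> Y" "e \<notin> D" "f \<in> U" "f \<notin> Y"
    and ij: "e \<in> H j \<longleftrightarrow> f \<in> H j"
    and sl: "e \<in> H i \<and> e \<in> H i' \<and> (f \<in> H i \<longleftrightarrow> f \<notin> H i') \<or> f \<notin> H i \<and> f \<notin> H i' \<and> (e \<in> H i \<longleftrightarrow> e \<notin> H i')"
  shows "corridor i i' j (insert f (Y - {e}))"
proof -
  let ?Z = "insert f (Y - {e})"
  have mZ: "mid ?Z" by (rule mid_swap[OF Y(1) e])
  have sw: "card (?Z \<inter> K) + of_bool (e \<in> K) = card (Y \<inter> K) + of_bool (f \<in> K)" for K
    using card_swap_Int[OF mid_finite[OF Y(1)] e(1,4)] .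
  have "tight (co ?Z) j" using tight_co_iff[OF Y(1) mZ Y(4)] sw[of "H j"] ij by auto
  moreover have "i \<in> I" "i' \<in> I" "card (Y \<inter> H i) = h i" "card (Y \<inter> H i') = h i'"
    using Y by (auto simp: tight_def)
  ultimately show ?thesis
    using mZ sw[of "H i"] sw[of "H i'"] sl unfolding corridor_def by (auto split: if_splits)
qed

text \<open>
  The intersection \<open>H i \<inter> H i'\<close> is contained in both \<open>A\<close> and \<open>B\<close>, and both are covered by the union.
\<close>

lemma obstructed_exact:
  assumes "obstructed i i' j j' A B" "x \<in> (A - B) \<union> (B - A)"
  shows "x \<in> H i \<longleftrightarrow> x \<notin> H i'"
  using obstructedD[OF assms(1)] assms(2) by blast

text \<open>
  Both \<open>Y\<close> and \<open>B\<close> contain \<open>e\<close>. Removing \<open>e\<close> from each of them leads into the same corridor, and the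
  path between the resulting sets has one step less than \<open>card (Y - B)\<close>. The missing step reinserts
  \<open>e\<close> at the end. The elements \<open>p\<close> and \<open>q\<close> that stand in for \<open>e\<close> must lie on the same side of \<open>H j\<close>
  as \<open>e\<close>, and \<open>crossed\<close> provides them.
\<close>

lemma detour_by_removal_aux:
  assumes ob: "obstructed i i' j j' Y B" and e: "e \<in> H i \<inter> H i'" "e \<notin> D" "e \<notin> H j"
  shows "\<exists>q\<in>B - Y. feasible (insert q (Y - {e})) \<and> (insert q (Y - {e}), B) \<in> adjacent ^^ card (Y - B)"
proof -
  have m: "mid Y" "mid B" and t: "tight Y i" "tight Y i'" "tight B i" "tight B i'"
    "tight (co Y) j" "tight (co B) j" and cr: "crossed (H j) Y B"
    using ob by (auto simp: obstructed_def)
  note D = obstructedD[OF ob] and ex = obstructed_exact[OF ob]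
  obtain p q where pq: "p \<in> Y - B" "p \<notin> H j" "q \<in> B - Y" "q \<notin> H j"
    using cr by (auto simp: crossed_def)
  have e': "e \<in> Y" "e \<in> B" using e D by auto
  have u: "p \<in> U" "q \<in> U" using pq m by (auto simp: mid_def)
  let ?V = "insert q (Y - {e})" and ?W = "insert p (B - {e})"
  have V: "corridor i i' j ?V"
    by (rule corridorI_swap) (use m t e e' pq u ex[of q] in auto)
  have W: "corridor i i' j ?W"
    by (rule corridorI_swap) (use m t e e' pq u ex[of p] in auto)
  have VW: "?V - ?W = (Y - B) - {p}" using pq e' by auto
  have WV: "?W - ?V = (B - Y) - {q}" using pq e' by auto
  have "(?V, ?W) \<in> adjacent ^^ card (?V - ?W)"
    by (rule corridor_path[OF V W]) (rule ex, use VW WV in blast)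
  moreover have "(?W, B) \<in> adjacent"
    using corridor_feasible[OF W] feasibleI_tight[OF m(2) t(3,6)] pq
    by (intro adjacentI[where x=p]) auto
  moreover have "Suc (card (?V - ?W)) = card (Y - B)"
    unfolding VW using pq(1) mid_finite[OF m(1)] by (intro card_Suc_Diff1) auto
  ultimately have "(?V, B) \<in> adjacent ^^ card (Y - B)" by (metis relpow_Suc_I)
  then show ?thesis using pq corridor_feasible[OF V] by blast
qed

text \<open>
  As \<open>e\<close> is in \<open>Y\<close> but not in \<open>D\<close>, it is not in \<open>co Y\<close>, which contains \<open>H j \<inter> H j'\<close>. Thus \<open>e\<close> avoids
  \<open>H j\<close> or \<open>H j'\<close>, and the corridor uses that hyperedge.
\<close>

lemma detour_by_removal:
  assumes ob: "obstructed i i' j j' Y B" and e: "e \<in> H i \<inter> H i'" "e \<notin> D"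
  shows "\<exists>q\<in>B - Y. feasible (insert q (Y - {e})) \<and> (insert q (Y - {e}), B) \<in> adjacent ^^ card (Y - B)"
proof (cases "e \<in> H j")
  case False
  then show ?thesis using detour_by_removal_aux[OF assms] by blast
next
  case True
  have "e \<in> Y" using obstructedD[OF ob] e by auto
  moreover have "H j \<inter> H j' \<subseteq> co Y" using obstructedD(3)[OF obstructed_co[OF ob]] .
  ultimately have "e \<notin> H j'" using True e by (auto simp: co_def)
  then show ?thesis using detour_by_removal_aux[OF obstructed_flip[OF ob] e] by blast
qed

text \<open>
  The counterpart with an element \<open>w\<close> outside both hyperedges. It belongs to neither \<open>Y\<close> nor \<open>B\<close>, stays
  in the set along the corridor, and is removed in the last step.
\<close>

lemma detour_by_insertion_aux:
  assumes ob: "obstructed i i' j j' Y B" and w: "w \<in> U" "w \<notin> H i \<union> H i'" "w \<in> H j"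
  shows "\<exists>p\<in>Y - B. feasible (insert w (Y - {p})) \<and> (insert w (Y - {p}), B) \<in> adjacent ^^ card (Y - B)"
proof -
  have m: "mid Y" "mid B" and t: "tight Y i" "tight Y i'" "tight B i" "tight B i'"
    "tight (co Y) j" "tight (co B) j" and cr: "crossed (H j) Y B"
    using ob by (auto simp: obstructed_def)
  note D = obstructedD[OF ob] and ex = obstructed_exact[OF ob]
  obtain p q where pq: "p \<in> Y - B" "p \<in> H j" "q \<in> B - Y" "q \<in> H j"
    using cr by (auto simp: crossed_def)
  have w': "w \<notin> Y" "w \<notin> B" using w D by auto
  have u: "p \<notin> D" "q \<notin> D" using pq m by (auto simp: mid_def)
  let ?V = "insert w (Y - {p})" and ?W = "insert w (B - {q})"
  have V: "corridor i i' j ?V"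
    by (rule corridorI_swap) (use m t w w' pq u ex[of p] in auto)
  have W: "corridor i i' j ?W"
    by (rule corridorI_swap) (use m t w w' pq u ex[of q] in auto)
  have VW: "?V - ?W = (Y - B) - {p}" using pq w' by auto
  have WV: "?W - ?V = (B - Y) - {q}" using pq w' by auto
  have "(?V, ?W) \<in> adjacent ^^ card (?V - ?W)"
    by (rule corridor_path[OF V W]) (rule ex, use VW WV in blast)
  moreover have "(?W, B) \<in> adjacent"
    using corridor_feasible[OF W] feasibleI_tight[OF m(2) t(3,6)] w'
    by (intro adjacentI[where x=w]) auto
  moreover have "Suc (card (?V - ?W)) = card (Y - B)"
    unfolding VW using pq(1) mid_finite[OF m(1)] by (intro card_Suc_Diff1) auto
  ultimately have "(?V, B) \<in> adjacent ^^ card (Y - B)" by (metis relpow_Suc_I)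
  then show ?thesis using pq corridor_feasible[OF V] by blast
qed

lemma detour_by_insertion:
  assumes ob: "obstructed i i' j j' Y B" and w: "w \<in> U" "w \<notin> H i \<union> H i'"
  shows "\<exists>p\<in>Y - B. feasible (insert w (Y - {p})) \<and> (insert w (Y - {p}), B) \<in> adjacent ^^ card (Y - B)"
proof (cases "w \<in> H j")
  case True
  then show ?thesis using detour_by_insertion_aux[OF assms] by blast
next
  case False
  have "w \<notin> Y" using obstructedD[OF ob] w by auto
  then have "w \<in> co Y" using w by (auto simp: co_def)
  moreover have "co Y \<subseteq> H j \<union> H j'" using obstructedD(1)[OF obstructed_co[OF ob]] .
  ultimately have "w \<in> H j'" using False by auto
  then show ?thesis using detour_by_insertion_aux[OF obstructed_flip[OF ob] w] by blast
qed

text \<open>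
  The set \<open>A = Y - z + w\<close> precedes \<open>Y\<close> on a monotone path to \<open>B\<close>. Instead of moving on to the
  obstructed \<open>Y\<close>, it steps to the start of a detour, which is adjacent to it as well: a detour that
  lacks \<open>z\<close> is reached by giving up \<open>w\<close>, and one that contains \<open>w\<close> by taking in \<open>z\<close>.
\<close>

lemma slack_avoids_obstruction:
  assumes ob: "obstructed i i' j j' Y B"
    and z: "z \<in> Y \<inter> B" "z \<notin> D" and w: "w \<in> U" "w \<notin> Y" "w \<notin> B"
    and A: "feasible (insert w (Y - {z}))"
    and slack: "z \<in> H i \<inter> H i' \<or> w \<notin> H i \<union> H i'"
  shows "(insert w (Y - {z}), B) \<in> adjacent ^^ Suc (card (Y - B))"
  using slack
proof
  assume "z \<in> H i \<inter> H i'"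
  then obtain q where q: "q \<in> B - Y" "feasible (insert q (Y - {z}))"
    "(insert q (Y - {z}), B) \<in> adjacent ^^ card (Y - B)"
    using detour_by_removal[OF ob] z by blast
  have "(insert w (Y - {z}), insert q (Y - {z})) \<in> adjacent"
    using A q w z by (intro adjacentI[where x=w]) auto
  then show ?thesis using q(3) by (rule relpow_Suc_I2)
next
  assume "w \<notin> H i \<union> H i'"
  then obtain p where p: "p \<in> Y - B" "feasible (insert w (Y - {p}))"
    "(insert w (Y - {p}), B) \<in> adjacent ^^ card (Y - B)"
    using detour_by_insertion[OF ob] w by blast
  have "(insert w (Y - {z}), insert w (Y - {p})) \<in> adjacent"
    using A p w z by (intro adjacentI[where x=p]) auto
  then show ?thesis using p(3) by (rule relpow_Suc_I2)
qed


section \<open>Monotone exchanges\<close>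

text \<open>
  An exchange changes the number of elements in a hyperedge by at most one, so it can violate only a
  constraint that is tight.
\<close>

lemma not_feasible_swap:
  assumes A: "feasible A" and p: "p \<in> A" "p \<notin> D" and q: "q \<in> U" "q \<notin> A"
    and no: "\<not> feasible (insert q (A - {p}))"
  shows "(\<exists>t. tight A t \<and> p \<notin> H t \<and> q \<in> H t) \<or> (\<exists>t. tight (co A) t \<and> p \<in> H t \<and> q \<notin> H t)"
proof -
  have mA: "mid A" using A by (rule feasible_mid)
  let ?Z = "insert q (A - {p})"
  have mZ: "mid ?Z" by (rule mid_swap[OF mA p q])
  have p': "p \<notin> co A" "q \<in> co A" using p q by (auto simp: co_def)
  have coZ: "co ?Z = insert p (co A - {q})" by (rule co_swap[OF mA p q])
  have "\<not> base ?Z \<or> \<not> base (co ?Z)" using no mZ by (auto simp: feasible_def)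
  then obtain t where t: "t \<in> I" "card (?Z \<inter> H t) > h t \<or> card (co ?Z \<inter> H t) > h t"
    using mZ mid_co[OF mZ] mid_S mid_card unfolding base_def by (meson not_le)
  have "card (?Z \<inter> H t) + of_bool (p \<in> H t) = card (A \<inter> H t) + of_bool (q \<in> H t)"
    using card_swap_Int[OF mid_finite[OF mA] p(1) q(2)] .
  moreover have "card (co ?Z \<inter> H t) + of_bool (q \<in> H t) = card (co A \<inter> H t) + of_bool (p \<in> H t)"
    unfolding coZ using card_swap_Int[OF mid_finite[OF mid_co[OF mA]] p'(2,1)] .
  ultimately show ?thesis
    using t feasible_le[OF A t(1)] unfolding tight_def of_bool_def by (fastforce split: if_splits)
qed

text \<open>
  An element of \<open>A\<close> avoids at most one hyperedge tight for \<open>A\<close>, and an element outside \<open>A\<close> lies in at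
  most one; for \<open>co A\<close> the roles are interchanged. So an element of \<open>P = A - B\<close> can be blocked by only
  one hyperedge on either side, and likewise for \<open>Q = B - A\<close>. If a single hyperedge blocked \<open>p\<close> against
  all of \<open>Q\<close>, then \<open>B\<close> or \<open>co B\<close> would violate its constraint. Hence each \<open>p\<close> is blocked from both
  sides, and comparing two elements of \<open>P\<close> that are blocked differently gives the four hyperedges.
\<close>

lemma monotone_step_or_obstructed:
  assumes A: "feasible A" and B: "feasible B" and "A \<noteq> B"
    and no: "\<And>p q. p \<in> A - B \<Longrightarrow> q \<in> B - A \<Longrightarrow> \<not> feasible (insert q (A - {p}))"
  shows "\<exists>i i' j j'. obstructed i i' j j' A B"
proof -
  have m: "mid A" "mid B" using A B feasible_mid by auto
  note fin = mid_finite[OF m(1)] mid_finite[OF m(2)]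
  define P Q where "P = A - B" and "Q = B - A"
  have fPQ: "finite P" "finite Q" using fin by (auto simp: P_def Q_def)
  have cPQ: "card P = card Q" using mid_Diff_card[OF m] by (simp add: P_def Q_def)
  have neP: "P \<noteq> {}" using \<open>A \<noteq> B\<close> cPQ fPQ unfolding P_def Q_def
    by (metis Diff_eq_empty_iff card_0_eq subset_antisym)
  have in_P: "p \<in> A" "p \<notin> co A" if "p \<in> P" for p
    using that m by (auto simp: P_def co_def mid_def)
  have in_Q: "q \<notin> A" "q \<in> co A" if "q \<in> Q" for q
    using that m by (auto simp: Q_def co_def mid_def)
  have blocked: "(\<exists>t. tight A t \<and> p \<notin> H t \<and> q \<in> H t) \<or> (\<exists>t. tight (co A) t \<and> p \<in> H t \<and> q \<notin> H t)"
    if "p \<in> P" "q \<in> Q" for p q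
    by (rule not_feasible_swap[OF A]) (use that no[of p q] m in \<open>auto simp: P_def Q_def mid_def\<close>)
  have cover: "X \<subseteq> H s \<union> H t" "H s \<inter> H t \<subseteq> X" if "mid X" "tight X s" "tight X t" "s \<noteq> t" for X s t
    using two_tight_cover[OF mid_S mid_card] two_tight_core[OF mid_S mid_card] that by auto
  note cA = cover[OF m(1)] and cC = cover[OF mid_co[OF m(1)]]
  have bal: "card (A \<inter> K) + card (Q \<inter> K) = card (B \<inter> K) + card (P \<inter> K)" for K
    using card_Int_balance[OF fin] by (simp add: P_def Q_def)
  have balco: "card (co A \<inter> K) + card (P \<inter> K) = card (co B \<inter> K) + card (Q \<inter> K)" for K
    using bal[of K] card_co_Int[OF m(1), of K] card_co_Int[OF m(2), of K] by linarith
  have leA: "card (Q \<inter> H t) \<le> card (P \<inter> H t)" if "tight A t" for t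
    using that bal[of "H t"] feasible_le(1)[OF B, of t] by (auto simp: tight_def)
  have leC: "card (P \<inter> H t) \<le> card (Q \<inter> H t)" if "tight (co A) t" for t
    using that balco[of "H t"] feasible_le(2)[OF B, of t] by (auto simp: tight_def)
  \<comment> \<open>Both sides are needed to block one \<open>p\<close>: otherwise uniqueness leaves a single hyperedge
    for all of \<open>Q\<close>, against \<open>leA\<close> or \<open>leC\<close>.\<close>
  have both: "\<exists>i j. tight A i \<and> p \<notin> H i \<and> Q \<inter> H i \<noteq> {} \<and> tight (co A) j \<and> p \<in> H j \<and> \<not> Q \<subseteq> H j \<and>
      (\<forall>q\<in>Q. q \<in> H i \<or> q \<notin> H j)" if p: "p \<in> P" for p
  proof -
    have "\<exists>q\<in>Q. \<exists>t. tight A t \<and> p \<notin> H t \<and> q \<in> H t"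
    proof (rule ccontr)
      assume n: "\<not> ?thesis"
      have "Q \<noteq> {}" using neP cPQ fPQ by auto
      then obtain j where j: "tight (co A) j" "p \<in> H j" using blocked[OF p] n by blast
      have "Q \<inter> H j = {}"
      proof (rule ccontr)
        assume "Q \<inter> H j \<noteq> {}"
        then obtain q where q: "q \<in> Q" "q \<in> H j" by auto
        then obtain t where t: "tight (co A) t" "p \<in> H t" "q \<notin> H t" using blocked[OF p] n by blast
        then show False using cC(2)[OF j(1) t(1)] j q in_P[OF p] by auto
      qed
      then have "P \<inter> H j = {}" using leC[OF j(1)] fPQ by auto
      then show False using p j by auto
    qed
    then obtain q1 i where i: "tight A i" "p \<notin> H i" "q1 \<in> Q" "q1 \<in> H i" by blast
    have "\<exists>q\<in>Q. \<exists>t. tight (co A) t \<and> p \<in> H t \<and> q \<notin> H t"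
    proof (rule ccontr)
      assume n: "\<not> ?thesis"
      have "Q \<subseteq> H i"
      proof
        fix q assume q: "q \<in> Q"
        then obtain t where t: "tight A t" "p \<notin> H t" "q \<in> H t" using blocked[OF p] n by blast
        then show "q \<in> H i" using cA(1)[OF i(1) t(1)] i in_P[OF p] by auto
      qed
      then have "card P \<le> card (P \<inter> H i)" using leA[OF i(1)] cPQ by (simp add: Int_absorb2)
      then have "P \<inter> H i = P" using card_seteq[of P "P \<inter> H i"] fPQ by auto
      then show False using p i by auto
    qed
    then obtain q2 j where j: "tight (co A) j" "p \<in> H j" "q2 \<in> Q" "q2 \<notin> H j" by blast
    have "q \<in> H i \<or> q \<notin> H j" if q: "q \<in> Q" for q
      using blocked[OF p q]
    proof (elim disjE exE)
      fix t assume t: "tight A t \<and> p \<notin> H t \<and> q \<in> H t"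
      then show ?thesis using cA(1)[OF i(1), of t] i in_P[OF p] by auto
    next
      fix t assume t: "tight (co A) t \<and> p \<in> H t \<and> q \<notin> H t"
      then show ?thesis using cC(2)[OF j(1), of t] j in_P[OF p] by auto
    qed
    then show ?thesis using i j by blast
  qed
  \<comment> \<open>The second element \<open>p2\<close> must lie in the hyperedge \<open>H i\<close> that blocks \<open>p1\<close>, so that its own
    blocking hyperedge \<open>H i'\<close> is a different one.\<close>
  obtain p1 where p1: "p1 \<in> P" using neP by auto
  obtain i j where ij: "tight A i" "p1 \<notin> H i" "Q \<inter> H i \<noteq> {}" "tight (co A) j" "p1 \<in> H j" "\<not> Q \<subseteq> H j"
    "\<forall>q\<in>Q. q \<in> H i \<or> q \<notin> H j" using both[OF p1] by blast
  have "P \<inter> H i \<noteq> {}" using leA[OF ij(1)] ij(3) fPQ by (auto simp: card_gt_0_iff)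
  then obtain p2 where p2: "p2 \<in> P" "p2 \<in> H i" by auto
  obtain i' j' where ij': "tight A i'" "p2 \<notin> H i'" "tight (co A) j'" "p2 \<in> H j'"
    "\<forall>q\<in>Q. q \<in> H i' \<or> q \<notin> H j'" using both[OF p2(1)] by blast
  have ni: "i \<noteq> i'" using p2 ij' by auto
  have Qi: "Q \<inter> H i \<inter> H i' = {}" using cA(2)[OF ij(1) ij'(1) ni] in_Q by auto
  have nj: "j \<noteq> j'"
  proof
    assume "j = j'"
    then have "Q \<inter> H j = {}" using ij(7) ij'(5) Qi by auto
    then have "P \<inter> H j = {}" using leC[OF ij(4)] fPQ by auto
    then show False using p1 ij by auto
  qed
  have Qj: "Q \<subseteq> H j \<union> H j'" using cC(1)[OF ij(4) ij'(3) nj] in_Q by auto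
  have Pi: "P \<subseteq> H i \<union> H i'" using cA(1)[OF ij(1) ij'(1) ni] in_P by auto
  have Pj: "P \<inter> H j \<inter> H j' = {}" using cC(2)[OF ij(4) ij'(3) nj] in_P by auto
  \<comment> \<open>Only two of the four types occur in \<open>Q\<close>; below, the other two are left for \<open>P\<close>.\<close>
  have Qtype: "(q \<in> H i \<longleftrightarrow> q \<in> H j) \<and> (q \<in> H i' \<longleftrightarrow> q \<notin> H i) \<and> (q \<in> H j' \<longleftrightarrow> q \<notin> H i)"
    if "q \<in> Q" for q
    using that ij(7) ij'(5) Qi Qj by blast
  obtain q1 where q1: "q1 \<in> Q" "q1 \<in> H i" using ij(3) by auto
  obtain q2 where q2: "q2 \<in> Q" "q2 \<notin> H j" using ij(6) by auto
  have a: "p \<notin> H i \<or> p \<in> H j'" if p: "p \<in> P" for p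
    using blocked[OF p q1(1)]
  proof (elim disjE exE)
    fix t assume t: "tight A t \<and> p \<notin> H t \<and> q1 \<in> H t"
    then show ?thesis using cA(2)[OF ij(1), of t] q1 in_Q[OF q1(1)] by auto
  next
    fix t assume t: "tight (co A) t \<and> p \<in> H t \<and> q1 \<notin> H t"
    then show ?thesis using cC(1)[OF ij'(3), of t] q1 in_Q[OF q1(1)] Qtype[OF q1(1)] by auto
  qed
  have b: "p \<notin> H i' \<or> p \<in> H j" if p: "p \<in> P" for p
    using blocked[OF p q2(1)]
  proof (elim disjE exE)
    fix t assume t: "tight A t \<and> p \<notin> H t \<and> q2 \<in> H t"
    then show ?thesis using cA(2)[OF ij'(1), of t] q2 in_Q[OF q2(1)] Qtype[OF q2(1)] by auto
  next
    fix t assume t: "tight (co A) t \<and> p \<in> H t \<and> q2 \<notin> H t"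
    then show ?thesis using cC(1)[OF ij(4), of t] q2 in_Q[OF q2(1)] by auto
  qed
  have Ptype: "(p \<in> H i \<longleftrightarrow> p \<in> H j') \<and> (p \<in> H i' \<longleftrightarrow> p \<notin> H i) \<and> (p \<in> H j \<longleftrightarrow> p \<notin> H i)"
    if "p \<in> P" for p
    using that a b Pi Pj by blast
  \<comment> \<open>By the types, the four inequalities \<open>leA\<close> and \<open>leC\<close> form a cycle, so that all of them are
    equalities and \<open>B\<close>, \<open>co B\<close> inherit the tightness.\<close>
  have "P \<inter> H j' = P \<inter> H i" "P \<inter> H i' = P \<inter> H j" "Q \<inter> H j = Q \<inter> H i" "Q \<inter> H j' = Q \<inter> H i'"
    using Ptype Qtype by blast+
  then have eqs: "card (P \<inter> H t) = card (Q \<inter> H t)" if "t \<in> {i, i', j, j'}" for t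
    using that leA[OF ij(1)] leA[OF ij'(1)] leC[OF ij(4)] leC[OF ij'(3)] by auto
  have "tight B t" if "t \<in> {i, i'}" for t
    using that eqs[of t] bal[of "H t"] ij(1) ij'(1) by (auto simp: tight_def)
  moreover have "tight (co B) t" if "t \<in> {j, j'}" for t
    using that eqs[of t] balco[of "H t"] ij(4) ij'(3) by (auto simp: tight_def)
  moreover have "crossed (H t) A B" if "t \<in> {i, i', j, j'}" for t
    unfolding crossed_def P_def[symmetric] Q_def[symmetric]
    using that p1 p2 q1 q2 Ptype[OF p1] Ptype[OF p2(1)] Qtype[OF q1(1)] Qtype[OF q2(1)] ij(2) by blast
  moreover have dist: "{i, i'} \<inter> {j, j'} = {}"
    using ij(2,5) p2 ij'(2,4) q1 q2 Qtype[OF q1(1)] Qtype[OF q2(1)] by blast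
  ultimately have "obstructed i i' j j' A B"
    using ij(1,4) ij'(1,3) ni nj dist m unfolding obstructed_def by blast
  then show ?thesis by blast
qed

lemma crossed_mono: "crossed K Y B \<Longrightarrow> Y - B \<subseteq> A - B \<Longrightarrow> B - Y \<subseteq> B - A \<Longrightarrow> crossed K A B"
  unfolding crossed_def by blast

text \<open>
  Feasibility of \<open>Y - z + w\<close> means that neither count may rise, and the loss of a tight constraint
  means that one of them falls. Since \<open>Y\<close> contains \<open>H i \<inter> H i'\<close> and is covered by \<open>H i \<union> H i'\<close>, the
  outgoing \<open>z\<close> lies in at least one of the two hyperedges and the incoming \<open>w\<close> in at most one. Hence
  \<open>z\<close> is in both or \<open>w\<close> in neither.
\<close>

lemma slack_if_not_tight:
  assumes ob: "obstructed i i' j j' Y B"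
    and z: "z \<in> Y" "z \<notin> D" and w: "w \<in> U" "w \<notin> Y"
    and A: "feasible (insert w (Y - {z}))"
    and nt: "\<not> (tight (insert w (Y - {z})) i \<and> tight (insert w (Y - {z})) i')"
  shows "z \<in> H i \<inter> H i' \<or> w \<notin> H i \<union> H i'"
proof -
  let ?A = "insert w (Y - {z})"
  have m: "mid Y" and t: "tight Y i" "tight Y i'" using ob by (auto simp: obstructed_def)
  have I: "i \<in> I" "i' \<in> I" using t by (auto simp: tight_def)
  note D = obstructedD[OF ob]
  have sw: "card (?A \<inter> K) + of_bool (z \<in> K) = card (Y \<inter> K) + of_bool (w \<in> K)" for K
    using card_swap_Int[OF mid_finite[OF m] z(1) w(2)] .
  show ?thesis
    using sw[of "H i"] sw[of "H i'"] feasible_le(1)[OF A I(1)] feasible_le(1)[OF A I(2)] nt t D z w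
    unfolding tight_def of_bool_def by (auto split: if_splits)
qed

text \<open>
  By induction along monotone steps. Suppose that the step from \<open>A\<close> to \<open>Y\<close> leads into an obstruction.
  If \<open>A\<close> has all the tightness of the obstruction, it is obstructed itself. Otherwise it has slack in
  the first or the second member, and a detour avoids \<open>Y\<close> without a loss.
\<close>

lemma monotone_path_or_obstructed:
  assumes "feasible A" "feasible B"
  shows "(A, B) \<in> adjacent ^^ card (A - B) \<or> (\<exists>i i' j j'. obstructed i i' j j' A B)"
  using assms(1)
proof (induction "card (A - B)" arbitrary: A)
  case 0
  have m: "mid A" "mid B" using 0 assms(2) feasible_mid by auto
  have "card (B - A) = 0" using mid_Diff_card[OF m] 0 by simp
  then have "A = B" using 0 mid_finite[OF m(1)] mid_finite[OF m(2)] by auto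
  then show ?case by simp
next
  case (Suc n)
  note A = \<open>feasible A\<close> and B = assms(2)
  have m: "mid A" "mid B" using A B feasible_mid by auto
  have "A \<noteq> B" using Suc(2) by auto
  show ?case
  proof (cases "\<exists>w\<in>A - B. \<exists>z\<in>B - A. feasible (insert z (A - {w}))")
    case False
    then show ?thesis using monotone_step_or_obstructed[OF A B \<open>A \<noteq> B\<close>] by blast
  next
    case True
    then obtain w z where wz: "w \<in> A - B" "z \<in> B - A" and Y: "feasible (insert z (A - {w}))" by blast
    define Y where "Y = insert z (A - {w})"
    have Y: "feasible Y" using Y by (simp add: Y_def)
    have YB: "Y - B = (A - B) - {w}" "B - Y = (B - A) - {z}" using wz by (auto simp: Y_def)
    have n: "n = card (Y - B)" unfolding YB using Suc(2) wz by simp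
    have AY: "A = insert w (Y - {z})" using wz by (auto simp: Y_def)
    have zw: "z \<in> Y \<inter> B" "z \<notin> D" "w \<in> U" "w \<notin> Y" "w \<notin> B"
      using wz m by (auto simp: Y_def mid_def)
    consider "(Y, B) \<in> adjacent ^^ n" | i i' j j' where "obstructed i i' j j' Y B"
      using Suc.hyps(1)[OF n Y] n by auto
    then show ?thesis
    proof cases
      case 1
      moreover have "(A, Y) \<in> adjacent"
        using A Y wz by (intro adjacentI[where x=w]) (auto simp: Y_def)
      ultimately show ?thesis unfolding Suc(2)[symmetric] using relpow_Suc_I2 by metis
    next
      case ob: 2
      have mY: "mid Y" using Y by (rule feasible_mid)
      have coA: "co A = insert z (co Y - {w})"
        unfolding AY using co_swap[OF mY] zw by auto
      have zwc: "w \<in> co Y \<inter> co B" "w \<notin> D" "z \<in> U" "z \<notin> co Y" "z \<notin> co B"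
        using zw m mY by (auto simp: co_def mid_def)
      note coob = obstructed_co[OF ob]
      show ?thesis
      proof (cases "tight A i \<and> tight A i'")
        case False
        have "(insert w (Y - {z}), B) \<in> adjacent ^^ Suc (card (Y - B))"
          by (rule slack_avoids_obstruction[OF ob zw])
            (use A False slack_if_not_tight[OF ob _ zw(2-4)] zw in \<open>auto simp: AY[symmetric]\<close>)
        then show ?thesis using n Suc(2) by (simp only: AY[symmetric]) simp
      next
        case t: True
        show ?thesis
        proof (cases "tight (co A) j \<and> tight (co A) j'")
          case False
          have "(insert z (co Y - {w}), co B) \<in> adjacent ^^ Suc (card (co Y - co B))"
            by (rule slack_avoids_obstruction[OF coob zwc])
              (use feasible_co[OF A] False slack_if_not_tight[OF coob _ zwc(2-4)] zwc in
                \<open>auto simp: coA[symmetric]\<close>)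
          then have "(co A, co B) \<in> adjacent ^^ Suc n"
            using co_Diff[OF mY m(2)] mid_Diff_card[OF mY m(2)] n by (simp only: coA[symmetric])
          from path_co[OF this] show ?thesis using co_co m Suc(2) by simp
        next
          case True
          have "crossed (H s) A B" if "s \<in> {i, i', j, j'}" for s
            by (rule crossed_mono[of _ Y]) (use that ob YB in \<open>auto simp: obstructed_def\<close>)
          then have "obstructed i i' j j' A B"
            using ob t True m unfolding obstructed_def by blast
          then show ?thesis by blast
        qed
      qed
    qed
  qed
qed

section \<open>Escaping an obstruction\<close>

text \<open>
  Adding the overlap conditions for \<open>(i, j)\<close> and \<open>(i', j')\<close>, and using that those for \<open>(i, i')\<close> and
  \<open>(j, j')\<close> hold with equality, gives
  \<open>card (H i \<inter> H j) + card (H i' \<inter> H j') \<le> card (H i \<inter> H i') + card (H j \<inter> H j')\<close>.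
  But if the two sets on the right are contained in \<open>D\<close>, which is covered by each pair of
  hyperedges, then each element is counted on the left at least as often as on the right, and \<open>x\<close> is
  counted once more.
\<close>

lemma obstructed_doubly_covered_aux:
  assumes ob: "obstructed i i' j j' A B"
    and sub: "H i \<inter> H i' \<subseteq> D" "H j \<inter> H j' \<subseteq> D"
    and x: "x \<in> (A - B) \<union> (B - A)" "x \<in> H i" "x \<in> H j"
  shows False
proof -
  have m: "mid A" "mid B" and I: "i \<in> I" "i' \<in> I" "j \<in> I" "j' \<in> I"
    using ob by (auto simp: obstructed_def tight_def)
  note D1 = obstructedD[OF ob] and D2 = obstructedD[OF obstructed_co[OF ob]]
  let ?C = "H i \<inter> H i'" and ?E = "H j \<inter> H j'" and ?F = "H i \<inter> H j" and ?G = "H i' \<inter> H j'"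
  have xD: "x \<notin> D" using x m by (auto simp: mid_def)
  have DD: "D \<subseteq> H i \<union> H i'" "D \<subseteq> H j \<union> H j'"
    using D1 D2 m mid_co[OF m(1)] by (auto simp: mid_def)
  have fin: "finite ?C" "finite ?E" "finite ?F" "finite ?G" using finite_H I by auto
  have "?C \<union> ?E \<subset> ?F \<union> ?G" using sub DD x xD by blast
  then have 1: "card (?C \<union> ?E) < card (?F \<union> ?G)" using fin by (intro psubset_card_mono) auto
  have 2: "?C \<inter> ?E = ?F \<inter> ?G" by blast
  have 3: "card ?C + card ?E < card ?F + card ?G"
    using 1 card_Un_Int[OF fin(1,2)] card_Un_Int[OF fin(3,4)] unfolding 2 by linarith
  have ne: "i \<noteq> j" "i' \<noteq> j'" using ob by (auto simp: obstructed_def)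
  show False
    using 3 overlap[OF I(1,3) ne(1)] overlap[OF I(2,4) ne(2)] D1(5) D2(5) by linarith
qed

lemma obstructed_doubly_covered:
  assumes ob: "obstructed i i' j j' A B"
  shows "\<not> (H i \<inter> H i' \<subseteq> D \<and> H j \<inter> H j' \<subseteq> D)"
proof
  assume sub: "H i \<inter> H i' \<subseteq> D \<and> H j \<inter> H j' \<subseteq> D"
  obtain x where x: "x \<in> A - B" "x \<in> H i" using ob by (auto simp: obstructed_def crossed_def)
  have "x \<in> co B - co A" using co_Diff[of B A] x(1) ob by (simp add: obstructed_def)
  then have "x \<in> H j \<or> x \<in> H j'" using obstructed_exact[OF obstructed_co[OF ob], of x] by blast
  then show False
    using obstructed_doubly_covered_aux[OF ob _ _ _ x(2)]
      obstructed_doubly_covered_aux[OF obstructed_flip[OF ob] _ _ _ x(2)] x sub by blast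
qed

lemma obstructed_path_removal:
  assumes ob: "obstructed i i' j j' A B" and A: "feasible A" and e: "e \<in> H i \<inter> H i'" "e \<notin> D"
  shows "(A, B) \<in> adjacent ^^ Suc (card (A - B))"
proof -
  obtain q where q: "q \<in> B - A" "feasible (insert q (A - {e}))"
    "(insert q (A - {e}), B) \<in> adjacent ^^ card (A - B)"
    using detour_by_removal[OF ob e] by blast
  have "(A, insert q (A - {e})) \<in> adjacent"
    using A q e obstructedD(3)[OF ob] by (intro adjacentI[where x=e]) auto
  then show ?thesis using q(3) by (rule relpow_Suc_I2)
qed

text \<open>
  The doubly covered element lies in \<open>A \<inter> B\<close>, or in \<open>co A \<inter> co B - D\<close>. In the second case \<open>A \<union> B\<close> is not
  all of \<open>U\<close>, and \<open>A \<inter> B\<close> is nonempty because its size exceeds that of \<open>D\<close> by the number of elements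
  of \<open>U\<close> that \<open>A \<union> B\<close> misses.
\<close>

theorem feasible_distance:
  assumes A: "feasible A" and B: "feasible B"
  shows "(A, B) \<in> adjacent ^^ card (A - B) \<or>
    A \<inter> B \<noteq> {} \<and> (A, B) \<in> adjacent ^^ Suc (card (A - B))"
proof (cases "(A, B) \<in> adjacent ^^ card (A - B)")
  case False
  then obtain i i' j j' where ob: "obstructed i i' j j' A B"
    using monotone_path_or_obstructed[OF A B] by blast
  have m: "mid A" "mid B" using A B feasible_mid by auto
  note coob = obstructed_co[OF ob]
  note D1 = obstructedD[OF ob] and D2 = obstructedD[OF coob]
  consider e where "e \<in> H i \<inter> H i'" "e \<notin> D" | e where "e \<in> H j \<inter> H j'" "e \<notin> D"
    using obstructed_doubly_covered[OF ob] by blast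
  then show ?thesis
  proof cases
    case (1 e)
    then have "e \<in> A \<inter> B" using D1(3,4) by blast
    then show ?thesis using obstructed_path_removal[OF ob A 1] by blast
  next
    case (2 e)
    have "(co A, co B) \<in> adjacent ^^ Suc (card (A - B))"
      using obstructed_path_removal[OF coob feasible_co[OF A] 2] co_Diff[OF m] mid_Diff_card[OF m]
      by simp
    from path_co[OF this] have p: "(A, B) \<in> adjacent ^^ Suc (card (A - B))"
      using co_co m by simp
    have "e \<in> co A" "e \<in> co B" using 2(1) D2(3,4) by blast+
    then have e: "e \<in> U" "e \<notin> A" "e \<notin> B" using 2(2) by (auto simp: co_def)
    have "A \<inter> B \<noteq> {}"
    proof
      assume d: "A \<inter> B = {}"
      have "D = {}" using d m by (auto simp: mid_def)
      have "card (A \<union> B) = card U"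
        using card_Un_disjoint[OF mid_finite[OF m(1)] mid_finite[OF m(2)] d] mid_card[OF m(1)] mid_card[OF m(2)]
          card_UD \<open>D = {}\<close> by simp
      moreover have "A \<union> B \<subset> U" using m e by (auto simp: mid_def)
      ultimately show False using psubset_card_mono[OF finite_U, of "A \<union> B"] by simp
    qed
    then show ?thesis using p by blast
  qed
qed simp

end

section \<open>Exchange sequences in elementary split matroids\<close>

definition compatible_bases :: "('a set \<Rightarrow> bool) \<Rightarrow> 'a set \<Rightarrow> 'a set \<Rightarrow> 'a set \<Rightarrow> 'a set \<Rightarrow> bool" where
  "compatible_bases indep A1 A2 B1 B2 \<longleftrightarrow>
     is_basis indep A1 \<and> is_basis indep A2 \<and> is_basis indep B1 \<and> is_basis indep B2 \<and>
     A1 \<inter> A2 = B1 \<inter> B2 \<and> A1 \<union> A2 = B1 \<union> B2"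

text \<open>
  In a straight matroid, every compatible pair of basis pairs is joined by a sequence that only
  brings in elements of the target, which is the shortest conceivable one. In a nearly straight
  matroid, one additional exchange is permitted unless \<open>A1\<close> and \<open>B1\<close> are disjoint.
\<close>

definition straight :: "('a set \<Rightarrow> bool) \<Rightarrow> bool" where
  "straight indep \<longleftrightarrow> (\<forall>A1 A2 B1 B2. compatible_bases indep A1 A2 B1 B2 \<longrightarrow>
     ((A1, A2), (B1, B2)) \<in> symmetric_exchange indep ^^ card (A1 - B1))"

definition nearly_straight :: "('a set \<Rightarrow> bool) \<Rightarrow> bool" where
  "nearly_straight indep \<longleftrightarrow> (\<forall>A1 A2 B1 B2. compatible_bases indep A1 A2 B1 B2 \<longrightarrow>
     ((A1, A2), (B1, B2)) \<in> symmetric_exchange indep ^^ card (A1 - B1) \<or>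
     A1 \<inter> B1 \<noteq> {} \<and> ((A1, A2), (B1, B2)) \<in> symmetric_exchange indep ^^ Suc (card (A1 - B1)))"

text \<open>
  Every maximal independent set has \<open>r\<close> elements. Suppose that \<open>X\<close> is maximal and smaller. Every element
  outside \<open>X\<close> then lies in a hyperedge where \<open>X\<close> is tight. By the overlap condition a set of less than
  \<open>r\<close> elements is tight at no more than one \<open>H i\<close>. So \<open>X\<close> contains \<open>S - H i\<close> besides \<open>h i\<close> elements
  of \<open>H i\<close>, which are at least \<open>r\<close> elements in total.
\<close>

lemma (in split_system) is_basis_iff_base:
  assumes indep: "\<And>X. indep X \<longleftrightarrow> X \<subseteq> S \<and> card X \<le> r \<and> (\<forall>i\<in>I. card (X \<inter> H i) \<le> h i)"
    and r: "r \<le> card S" and room: "\<And>i. i \<in> I \<Longrightarrow> card (S - H i) + h i \<ge> r"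
  shows "is_basis indep X \<longleftrightarrow> base X"
proof
  assume "base X"
  then have X: "indep X" "card X = r" by (auto simp: indep base_def)
  have "Y = X" if "indep Y" "X \<subseteq> Y" for Y
  proof -
    have "finite Y" "card Y \<le> r" using that(1) finite_S finite_subset by (auto simp: indep)
    then show ?thesis using card_seteq[of Y X] that(2) X(2) by auto
  qed
  then show "is_basis indep X" using X by (auto simp: is_basis_def)
next
  assume b: "is_basis indep X"
  then have X: "X \<subseteq> S" "card X \<le> r" "\<forall>i\<in>I. card (X \<inter> H i) \<le> h i"
    and max: "\<And>Y. indep Y \<Longrightarrow> X \<subseteq> Y \<Longrightarrow> Y = X" by (auto simp: is_basis_def indep)
  have fX: "finite X" using X(1) finite_S finite_subset by blast
  have "card X = r"
  proof (rule ccontr)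
    assume "card X \<noteq> r"
    then have lt: "card X < r" using X(2) by simp
    have full: "\<exists>i\<in>I. x \<in> H i \<and> card (X \<inter> H i) = h i" if x: "x \<in> S - X" for x
    proof (rule ccontr)
      assume n: "\<not> ?thesis"
      have "card (insert x X \<inter> H i) \<le> h i" if i: "i \<in> I" for i
      proof (cases "x \<in> H i")
        case True
        then have "card (X \<inter> H i) < h i" using n i X(3) by force
        then show ?thesis using True fX x by (simp add: Int_insert_left)
      next
        case False
        then show ?thesis using X(3) i by (simp add: Int_insert_left)
      qed
      then have "indep (insert x X)" using X(1) x lt fX by (auto simp: indep)
      then show False using max[of "insert x X"] x by auto
    qed
    have unique: "i = i'" if "i \<in> I" "i' \<in> I" "card (X \<inter> H i) = h i" "card (X \<inter> H i') = h i'" for i i'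
    proof (rule ccontr)
      assume ne: "i \<noteq> i'"
      have "h i + h i' = card (X \<inter> H i \<union> X \<inter> H i') + card (X \<inter> H i \<inter> (X \<inter> H i'))"
        using card_Un_Int[of "X \<inter> H i" "X \<inter> H i'"] fX that by simp
      also have "\<dots> \<le> card X + card (H i \<inter> H i')"
        by (intro add_mono card_mono) (use fX finite_H[OF that(1)] in auto)
      finally show False using overlap[OF that(1,2) ne] lt by simp
    qed
    have "S - X \<noteq> {}" using lt r X(1) by auto
    then obtain x i where i: "i \<in> I" "card (X \<inter> H i) = h i" using full by blast
    have "S - H i \<subseteq> X" using full unique i by blast
    then have "card (S - H i) + card (X \<inter> H i) = card ((S - H i) \<union> (X \<inter> H i))"
      using fX finite_S by (intro card_Un_disjoint[symmetric]) auto
    also have "\<dots> \<le> card X" using \<open>S - H i \<subseteq> X\<close> fX by (intro card_mono) auto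
    finally show False using room[OF i(1)] i(2) lt by simp
  qed
  then show "base X" using X by (simp add: base_def)
qed

lemma (in split_pair) adjacent_symmetric_exchange:
  assumes bases: "\<And>X. is_basis indep X \<longleftrightarrow> base X" and XY: "(X, Y) \<in> adjacent"
  shows "((X, co X), (Y, co Y)) \<in> symmetric_exchange indep"
proof -
  have f: "feasible X" "feasible Y" and c: "card (X - Y) = 1" using XY by (auto simp: adjacent_def)
  have m: "mid X" "mid Y" using f feasible_mid by auto
  obtain e where e: "X - Y = {e}" using c by (auto simp: card_1_singleton_iff)
  obtain f where f': "Y - X = {f}" using c mid_Diff_card[OF m] by (auto simp: card_1_singleton_iff)
  have Y: "Y = insert f (X - {e})" using e f' by auto
  have ef: "e \<in> X" "e \<notin> D" "f \<in> U" "f \<notin> X" using e f' m by (auto simp: mid_def)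
  have "co Y = insert e (co X - {f})" unfolding Y by (rule co_swap[OF m(1) ef])
  moreover have "e \<noteq> f" using ef by auto
  ultimately have coY: "co Y = insert e (co X) - {f}" by auto
  have "is_basis indep X" "is_basis indep (co X)" "is_basis indep Y" "is_basis indep (co Y)"
    using f bases by (auto simp: feasible_def)
  moreover have "e \<in> X - co X" "f \<in> co X - X" using ef by (auto simp: co_def)
  ultimately show ?thesis
    unfolding symmetric_exchange_def
    by (intro CollectI exI[of _ X] exI[of _ "co X"] exI[of _ e] exI[of _ f])
      (simp add: Y[symmetric] coY[symmetric])
qed

lemma relpow_map:
  assumes "(x, y) \<in> R ^^ n" "\<And>x y. (x, y) \<in> R \<Longrightarrow> (f x, f y) \<in> R'"
  shows "(f x, f y) \<in> R' ^^ n"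
  using assms(1)
proof (induction n arbitrary: y)
  case (Suc n)
  then obtain z where "(x, z) \<in> R ^^ n" "(z, y) \<in> R" by (auto elim: relpow_Suc_E)
  then show ?case using Suc.IH assms(2) by (meson relpow_Suc_I)
qed simp

lemma (in split_system) exchange_sequences:
  assumes bases: "\<And>X. is_basis indep X \<longleftrightarrow> base X" and c: "compatible_bases indep A1 A2 B1 B2"
  shows "((A1, A2), (B1, B2)) \<in> symmetric_exchange indep ^^ card (A1 - B1) \<or>
     I \<noteq> {} \<and> A1 \<inter> B1 \<noteq> {} \<and> ((A1, A2), (B1, B2)) \<in> symmetric_exchange indep ^^ Suc (card (A1 - B1))"
proof -
  have b: "base A1" "base A2" "base B1" "base B2" and eq: "A1 \<inter> A2 = B1 \<inter> B2" "A1 \<union> A2 = B1 \<union> B2"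
    using c bases by (auto simp: compatible_bases_def)
  have S: "A1 \<subseteq> S" "A2 \<subseteq> S" "card A1 = r" "card A2 = r" "card B1 = r" using b by (auto simp: base_def)
  have fin: "finite A1" "finite A2" using S finite_S finite_subset by blast+
  interpret split_pair S r I H h "A1 \<union> A2" "A1 \<inter> A2"
    by unfold_locales (use S card_Un_Int[OF fin] in auto)
  have co: "co A1 = A2" "co B1 = B2" using eq unfolding co_def by blast+
  have f: "feasible A1" "feasible B1"
    unfolding feasible_def co mid_def using b S eq by auto
  have lift: "((A1, A2), (B1, B2)) \<in> symmetric_exchange indep ^^ n" if "(A1, B1) \<in> adjacent ^^ n" for n
    using relpow_map[OF that, of "\<lambda>X. (X, co X)" "symmetric_exchange indep"]
      adjacent_symmetric_exchange[OF bases] co by simp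
  show ?thesis
  proof (cases "I = {}")
    case True
    then have "\<not> obstructed i i' j j' A1 B1" for i i' j j'
      unfolding obstructed_def tight_def by blast
    then show ?thesis using monotone_path_or_obstructed[OF f] lift by blast
  qed (use feasible_distance[OF f] lift in blast)
qed

lemma elementary_split_nearly_straight:
  assumes "elementary_split_matroid S indep"
  shows "nearly_straight indep"
proof -
  obtain r q :: nat and H :: "nat \<Rightarrow> 'a set" and h :: "nat \<Rightarrow> nat" where fin: "finite S" and r: "r \<le> card S" and H: "\<forall>i<q. H i \<subseteq> S"
    and ov: "\<forall>i j. i < j \<longrightarrow> j < q \<longrightarrow> int (card (H i \<inter> H j)) \<le> int (h i) + int (h j) - int r"
    and room: "\<forall>i<q. card (S - H i) + h i \<ge> r"
    and indep: "\<forall>X. indep X \<longleftrightarrow> X \<subseteq> S \<and> card X \<le> r \<and> (\<forall>i<q. card (X \<inter> H i) \<le> h i)"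
    using assms unfolding elementary_split_matroid_def by (elim conjE exE) (rule that)
  have ov': "card (H i \<inter> H j) + r \<le> h i + h j" if "i < j" "j < q" for i j :: nat
    using ov that by force
  interpret split_system S r "{..<q}" H h
  proof
    fix i j assume "i \<in> {..<q}" "j \<in> {..<q}" "i \<noteq> j"
    then show "card (H i \<inter> H j) + r \<le> h i + h j"
      using ov'[of i j] ov'[of j i] by (cases "i < j") (auto simp: Int_commute)
  qed (use fin H in auto)
  have bases: "is_basis indep X \<longleftrightarrow> base X" for X
    by (rule is_basis_iff_base) (use indep r room in auto)
  show ?thesis
    unfolding nearly_straight_def
  proof (intro allI impI)
    fix A1 A2 B1 B2 assume "compatible_bases indep A1 A2 B1 B2"
    from exchange_sequences[OF bases this]
    show "((A1, A2), B1, B2) \<in> symmetric_exchange indep ^^ card (A1 - B1) \<or>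
      A1 \<inter> B1 \<noteq> {} \<and> ((A1, A2), B1, B2) \<in> symmetric_exchange indep ^^ Suc (card (A1 - B1))"
      by blast
  qed
qed

text \<open>
  A uniform matroid is the case of an elementary split matroid without hyperedges, where nothing can
  be obstructed.
\<close>

lemma uniform_straight:
  assumes "finite S" "uniform_matroid S indep"
  shows "straight indep"
proof -
  obtain r where r: "r \<le> card S" "\<forall>X. indep X \<longleftrightarrow> X \<subseteq> S \<and> card X \<le> r"
    using assms(2) by (auto simp: uniform_matroid_def)
  interpret split_system S r "{} :: nat set" "\<lambda>_. {}" "\<lambda>_. 0" by unfold_locales (use assms in auto)
  have bases: "is_basis indep X \<longleftrightarrow> base X" for X
    by (rule is_basis_iff_base) (use r in auto)
  show ?thesis
    unfolding straight_def
  proof (intro allI impI)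
    fix A1 A2 B1 B2 assume "compatible_bases indep A1 A2 B1 B2"
    from exchange_sequences[OF bases this]
    show "((A1, A2), B1, B2) \<in> symmetric_exchange indep ^^ card (A1 - B1)" by blast
  qed
qed

section \<open>Direct sums\<close>

locale matroid_sum =
  fixes S1 S2 :: "'a set" and indep1 indep2 :: "'a set \<Rightarrow> bool"
  assumes matroid1: "matroid S1 indep1" and matroid2: "matroid S2 indep2"
    and disjoint: "S1 \<inter> S2 = {}"
begin

abbreviation indep :: "'a set \<Rightarrow> bool" where
  "indep \<equiv> direct_sum_indep S1 indep1 S2 indep2"

lemma ground: "indep1 X \<Longrightarrow> X \<subseteq> S1" "indep2 X \<Longrightarrow> X \<subseteq> S2"
  using matroid.indep_subset_ground matroid1 matroid2 by blast+

lemma basis_ground: "is_basis indep1 X \<Longrightarrow> X \<subseteq> S1" "is_basis indep2 X \<Longrightarrow> X \<subseteq> S2"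
  using ground by (auto simp: is_basis_def)

lemma is_basis_traces:
  assumes "is_basis indep X"
  shows "X \<subseteq> S1 \<union> S2" "is_basis indep1 (X \<inter> S1)" "is_basis indep2 (X \<inter> S2)"
proof -
  have X: "X \<subseteq> S1 \<union> S2" "indep1 (X \<inter> S1)" "indep2 (X \<inter> S2)"
    and max: "\<And>Y. indep Y \<Longrightarrow> X \<subseteq> Y \<Longrightarrow> Y = X"
    using assms by (auto simp: is_basis_def direct_sum_indep_def)
  show "X \<subseteq> S1 \<union> S2" by (rule X)
  have "Z = X \<inter> S1" if Z: "indep1 Z" "X \<inter> S1 \<subseteq> Z" for Z
  proof -
    have t: "(Z \<union> X \<inter> S2) \<inter> S1 = Z" "(Z \<union> X \<inter> S2) \<inter> S2 = X \<inter> S2"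
      using ground(1)[OF Z(1)] disjoint by auto
    have "Z \<union> X \<inter> S2 = X"
      using max[of "Z \<union> X \<inter> S2"] t X Z ground(1)[OF Z(1)] unfolding direct_sum_indep_def by auto
    then show ?thesis using t by metis
  qed
  then show "is_basis indep1 (X \<inter> S1)" using X by (simp add: is_basis_def)
  have "Z = X \<inter> S2" if Z: "indep2 Z" "X \<inter> S2 \<subseteq> Z" for Z
  proof -
    have t: "(Z \<union> X \<inter> S1) \<inter> S2 = Z" "(Z \<union> X \<inter> S1) \<inter> S1 = X \<inter> S1"
      using ground(2)[OF Z(1)] disjoint by auto
    have "Z \<union> X \<inter> S1 = X"
      using max[of "Z \<union> X \<inter> S1"] t X Z ground(2)[OF Z(1)] unfolding direct_sum_indep_def by auto
    then show ?thesis using t by metis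
  qed
  then show "is_basis indep2 (X \<inter> S2)" using X by (simp add: is_basis_def)
qed

lemma is_basis_union:
  assumes B: "is_basis indep1 B" and C: "is_basis indep2 C"
  shows "is_basis indep (B \<union> C)"
  unfolding is_basis_def
proof (intro conjI allI impI)
  have BC: "B \<subseteq> S1" "C \<subseteq> S2" using basis_ground B C by auto
  then have t: "(B \<union> C) \<inter> S1 = B" "(B \<union> C) \<inter> S2 = C" using disjoint by auto
  show "indep (B \<union> C)" using B C BC by (auto simp: direct_sum_indep_def t is_basis_def)
  fix X assume X: "indep X" "B \<union> C \<subseteq> X"
  then have "X \<inter> S1 = B" "X \<inter> S2 = C" "X \<subseteq> S1 \<union> S2"
    using B C BC by (auto simp: direct_sum_indep_def is_basis_def)
  then show "X = B \<union> C" by auto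
qed

text \<open>
  An exchange in one summand remains an exchange of the sum when arbitrary bases of the other summand
  are added to the two members.
\<close>

lemma symmetric_exchange_summand:
  assumes PQ: "(P, Q) \<in> symmetric_exchange indep1"
    and C: "is_basis indep2 C1" "is_basis indep2 C2"
  shows "((fst P \<union> C1, snd P \<union> C2), (fst Q \<union> C1, snd Q \<union> C2)) \<in> symmetric_exchange indep"
proof -
  obtain X1 X2 e f where P: "P = (X1, X2)" and Q: "Q = (insert f (X1 - {e}), insert e X2 - {f})"
    and b: "is_basis indep1 X1" "is_basis indep1 X2" "is_basis indep1 (insert f (X1 - {e}))"
      "is_basis indep1 (insert e X2 - {f})"
    and ef: "e \<in> X1 - X2" "f \<in> X2 - X1"
    using PQ by (auto simp: symmetric_exchange_def)
  have "e \<in> S1" "f \<in> S1" using ef b basis_ground by blast+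
  then have n: "e \<notin> C1" "e \<notin> C2" "f \<notin> C1" "f \<notin> C2" using basis_ground(2) C disjoint by blast+
  have eq: "insert f (X1 - {e}) \<union> C1 = insert f ((X1 \<union> C1) - {e})"
    "insert e X2 - {f} \<union> C2 = insert e (X2 \<union> C2) - {f}" using n by auto
  have "is_basis indep (X1 \<union> C1)" "is_basis indep (X2 \<union> C2)"
    "is_basis indep (insert f ((X1 \<union> C1) - {e}))" "is_basis indep (insert e (X2 \<union> C2) - {f})"
    unfolding eq[symmetric] by (intro is_basis_union b C)+
  then show ?thesis
    unfolding P Q fst_conv snd_conv eq symmetric_exchange_def
    by (intro CollectI exI[of _ "X1 \<union> C1"] exI[of _ "X2 \<union> C2"] exI[of _ e] exI[of _ f])
      (use ef n in auto)
qed

lemma path_summand: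
  assumes "(P, Q) \<in> symmetric_exchange indep1 ^^ n" "is_basis indep2 C1" "is_basis indep2 C2"
  shows "((fst P \<union> C1, snd P \<union> C2), (fst Q \<union> C1, snd Q \<union> C2)) \<in> symmetric_exchange indep ^^ n"
  using relpow_map[OF assms(1), of "\<lambda>P. (fst P \<union> C1, snd P \<union> C2)"]
    symmetric_exchange_summand[OF _ assms(2,3)] by blast

lemma compatible_summand:
  assumes "compatible_bases indep A1 A2 B1 B2"
  shows "compatible_bases indep1 (A1 \<inter> S1) (A2 \<inter> S1) (B1 \<inter> S1) (B2 \<inter> S1)"
proof -
  have "A1 \<inter> S1 \<inter> (A2 \<inter> S1) = B1 \<inter> S1 \<inter> (B2 \<inter> S1)" "A1 \<inter> S1 \<union> A2 \<inter> S1 = B1 \<inter> S1 \<union> B2 \<inter> S1"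
    using assms unfolding compatible_bases_def by blast+
  then show ?thesis using assms is_basis_traces unfolding compatible_bases_def by blast
qed

end

lemma direct_sum_indep_commute:
  "direct_sum_indep S1 indep1 S2 indep2 = direct_sum_indep S2 indep2 S1 indep1"
  unfolding direct_sum_indep_def by (intro ext) (auto simp: Un_commute)

lemma matroid_sum_commute: "matroid_sum S1 S2 indep1 indep2 \<Longrightarrow> matroid_sum S2 S1 indep2 indep1"
  by (auto simp: matroid_sum_def)

context matroid_sum
begin

text \<open>
  The path first transforms the traces on \<open>S1\<close>, then those on \<open>S2\<close>.
\<close>

lemma path_sum:
  assumes c: "compatible_bases indep A1 A2 B1 B2"
    and p1: "((A1 \<inter> S1, A2 \<inter> S1), (B1 \<inter> S1, B2 \<inter> S1)) \<in> symmetric_exchange indep1 ^^ m"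
    and p2: "((A1 \<inter> S2, A2 \<inter> S2), (B1 \<inter> S2, B2 \<inter> S2)) \<in> symmetric_exchange indep2 ^^ n"
  shows "((A1, A2), (B1, B2)) \<in> symmetric_exchange indep ^^ (m + n)"
proof -
  have A: "is_basis indep A1" "is_basis indep A2" "is_basis indep B1" "is_basis indep B2"
    using c by (auto simp: compatible_bases_def)
  interpret sw: matroid_sum S2 S1 indep2 indep1
    by (rule matroid_sum_commute) (rule matroid_sum_axioms)
  have split: "X \<inter> S1 \<union> X \<inter> S2 = X" "X \<inter> S2 \<union> X \<inter> S1 = X" if "is_basis indep X" for X
    using is_basis_traces(1)[OF that] by auto
  have "((A1, A2), (B1 \<inter> S1 \<union> A1 \<inter> S2, B2 \<inter> S1 \<union> A2 \<inter> S2)) \<in> symmetric_exchange indep ^^ m"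
    using path_summand[OF p1 is_basis_traces(3)[OF A(1)] is_basis_traces(3)[OF A(2)]]
    by (simp add: split A)
  moreover have "((B1 \<inter> S1 \<union> A1 \<inter> S2, B2 \<inter> S1 \<union> A2 \<inter> S2), (B1, B2)) \<in> symmetric_exchange indep ^^ n"
    using sw.path_summand[OF p2 is_basis_traces(2)[OF A(3)] is_basis_traces(2)[OF A(4)]]
    by (simp add: split A direct_sum_indep_commute[of S2] Un_commute[of _ "A1 \<inter> S2"] Un_commute[of _ "A2 \<inter> S2"])
  ultimately show ?thesis unfolding relpow_add by blast
qed

lemma card_Diff_sum:
  assumes "is_basis indep A" "is_basis indep B"
  shows "card (A - B) = card (A \<inter> S1 - B \<inter> S1) + card (A \<inter> S2 - B \<inter> S2)"
proof -
  have "A - B = (A \<inter> S1 - B \<inter> S1) \<union> (A \<inter> S2 - B \<inter> S2)"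
    using is_basis_traces(1)[OF assms(1)] by auto
  moreover have "card \<dots> = card (A \<inter> S1 - B \<inter> S1) + card (A \<inter> S2 - B \<inter> S2)"
    using matroid.finite_ground[OF matroid1] matroid.finite_ground[OF matroid2] disjoint
    by (intro card_Un_disjoint) auto
  ultimately show ?thesis by simp
qed

lemma compatible_summand2:
  "compatible_bases indep A1 A2 B1 B2 \<Longrightarrow>
    compatible_bases indep2 (A1 \<inter> S2) (A2 \<inter> S2) (B1 \<inter> S2) (B2 \<inter> S2)"
  using matroid_sum.compatible_summand[OF matroid_sum_commute[OF matroid_sum_axioms]]
  by (simp add: direct_sum_indep_commute[of S2])

lemma straight_sum:
  assumes "straight indep1" "straight indep2"
  shows "straight indep"
  unfolding straight_def
proof (intro allI impI)
  fix A1 A2 B1 B2 assume c: "compatible_bases indep A1 A2 B1 B2"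
  then have "card (A1 - B1) = card (A1 \<inter> S1 - B1 \<inter> S1) + card (A1 \<inter> S2 - B1 \<inter> S2)"
    by (intro card_Diff_sum) (auto simp: compatible_bases_def)
  then show "((A1, A2), B1, B2) \<in> symmetric_exchange indep ^^ card (A1 - B1)"
    using path_sum[OF c] assms compatible_summand[OF c] compatible_summand2[OF c]
    by (simp add: straight_def)
qed

lemma nearly_straight_sum:
  assumes "straight indep1" "nearly_straight indep2"
  shows "nearly_straight indep"
  unfolding nearly_straight_def
proof (intro allI impI)
  fix A1 A2 B1 B2 assume c: "compatible_bases indep A1 A2 B1 B2"
  let ?m = "card (A1 \<inter> S1 - B1 \<inter> S1)" and ?n = "card (A1 \<inter> S2 - B1 \<inter> S2)"
  have mn: "card (A1 - B1) = ?m + ?n"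
    using c by (intro card_Diff_sum) (auto simp: compatible_bases_def)
  have p1: "((A1 \<inter> S1, A2 \<inter> S1), (B1 \<inter> S1, B2 \<inter> S1)) \<in> symmetric_exchange indep1 ^^ ?m"
    using assms(1) compatible_summand[OF c] by (simp add: straight_def)
  consider "((A1 \<inter> S2, A2 \<inter> S2), (B1 \<inter> S2, B2 \<inter> S2)) \<in> symmetric_exchange indep2 ^^ ?n"
    | "A1 \<inter> S2 \<inter> (B1 \<inter> S2) \<noteq> {}"
      "((A1 \<inter> S2, A2 \<inter> S2), (B1 \<inter> S2, B2 \<inter> S2)) \<in> symmetric_exchange indep2 ^^ Suc ?n"
    using assms(2) compatible_summand2[OF c] unfolding nearly_straight_def by blast
  then show "((A1, A2), B1, B2) \<in> symmetric_exchange indep ^^ card (A1 - B1) \<or>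
      A1 \<inter> B1 \<noteq> {} \<and> ((A1, A2), B1, B2) \<in> symmetric_exchange indep ^^ Suc (card (A1 - B1))"
  proof cases
    case 1
    then show ?thesis using path_sum[OF c p1] mn by simp
  next
    case 2
    have "((A1, A2), B1, B2) \<in> symmetric_exchange indep ^^ (?m + Suc ?n)"
      by (rule path_sum[OF c p1 2(2)])
    then show ?thesis using 2(1) mn by auto
  qed
qed

lemma restrict_summand: "C \<subseteq> S1 \<Longrightarrow> restrict_indep indep C = restrict_indep indep1 C"
proof (rule ext)
  fix X assume C: "C \<subseteq> S1"
  have "X \<inter> S1 = X" "X \<inter> S2 = {}" if "X \<subseteq> C" using that C disjoint by auto
  then show "restrict_indep indep C X = restrict_indep indep1 C X"
    using C matroid.indep_empty[OF matroid2] by (auto simp: restrict_indep_def direct_sum_indep_def)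
qed

text \<open>
  A direct summand of \<open>S1\<close> splits off from the sum as well, with the rest of \<open>S1\<close> and all of \<open>S2\<close> as
  its complement. Components can therefore be found by decomposing repeatedly into two summands.
\<close>

lemma component_summand:
  assumes "is_component S1 indep1 C"
  shows "is_component (S1 \<union> S2) indep C"
proof -
  let ?S = "S1 \<union> S2"
  have C: "C \<subseteq> S1" "C \<noteq> {}" "connected_matroid C (restrict_indep indep1 C)"
    and eq: "indep1 = direct_sum_indep C (restrict_indep indep1 C) (S1 - C) (restrict_indep indep1 (S1 - C))"
    using assms by (auto simp: is_component_def)
  have e: "indep2 {}" using matroid.indep_empty[OF matroid2] .
  have eq1: "indep1 (X \<inter> S1) \<longleftrightarrow> indep1 (X \<inter> C) \<and> indep1 (X \<inter> (S1 - C))" for X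
  proof -
    have t: "X \<inter> S1 \<inter> C = X \<inter> C" "X \<inter> S1 \<inter> (S1 - C) = X \<inter> (S1 - C)" "X \<inter> S1 \<subseteq> C \<union> (S1 - C)"
      using C by auto
    show ?thesis using t fun_cong[OF eq, of "X \<inter> S1"]
      by (simp add: direct_sum_indep_def restrict_indep_def)
  qed
  have "indep X = direct_sum_indep C (restrict_indep indep C) (?S - C) (restrict_indep indep (?S - C)) X" for X
  proof -
    have t: "X \<inter> C \<inter> S1 = X \<inter> C" "X \<inter> C \<inter> S2 = {}" "X \<inter> (?S - C) \<inter> S1 = X \<inter> (S1 - C)"
      "X \<inter> (?S - C) \<inter> S2 = X \<inter> S2" "C \<union> (?S - C) = ?S" "X \<inter> C \<subseteq> ?S" "X \<inter> (?S - C) \<subseteq> ?S"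
      using C disjoint by auto
    show ?thesis
      unfolding direct_sum_indep_def restrict_indep_def t using eq1[of X] t(6,7) e by auto
  qed
  then show ?thesis
    unfolding is_component_def using C restrict_summand[OF C(1)] by auto
qed

end

section \<open>Split matroids\<close>

lemma restrict_ground: "matroid S indep \<Longrightarrow> restrict_indep indep S = indep"
  using matroid.indep_subset_ground unfolding restrict_indep_def by (intro ext) blast

lemma connected_component:
  assumes "matroid S indep" "S \<noteq> {}" "connected_matroid S indep"
  shows "is_component S indep S"
  unfolding is_component_def restrict_ground[OF assms(1)]
  using assms(2,3) matroid.indep_empty[OF assms(1)] matroid.indep_subset_ground[OF assms(1)]
  by (auto simp: direct_sum_indep_def restrict_indep_def fun_eq_iff Int_absorb2)

lemma disconnected_sum:
  assumes "matroid S indep" "\<not> connected_matroid S indep"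
  obtains S1 S2 indep1 indep2 where "matroid_sum S1 S2 indep1 indep2" "S = S1 \<union> S2"
    "indep = direct_sum_indep S1 indep1 S2 indep2" "card S1 < card S" "card S2 < card S"
proof -
  obtain S1 indep1 S2 indep2 where s: "matroid S1 indep1" "matroid S2 indep2"
    "S1 \<noteq> {}" "S2 \<noteq> {}" "S1 \<inter> S2 = {}" "S1 \<union> S2 = S" "indep = direct_sum_indep S1 indep1 S2 indep2"
    using assms(2) unfolding connected_matroid_def by blast
  have "finite S" using assms(1) by (rule matroid.finite_ground)
  moreover have "S1 \<subset> S" "S2 \<subset> S" using s by auto
  ultimately have "card S1 < card S" "card S2 < card S" by (auto intro: psubset_card_mono)
  then show ?thesis using that s by (auto simp: matroid_sum_def)
qed

lemma straight_if_components_uniform: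
  assumes "matroid S indep"
    and "\<And>C. is_component S indep C \<Longrightarrow> uniform_matroid C (restrict_indep indep C)"
  shows "straight indep"
  using assms
proof (induction "card S" arbitrary: S indep rule: less_induct)
  case less
  note M = less.prems(1)
  have fin: "finite S" using M by (rule matroid.finite_ground)
  consider "S = {}" | "S \<noteq> {}" "connected_matroid S indep" | "\<not> connected_matroid S indep" by blast
  then show ?case
  proof cases
    case 1
    then have "uniform_matroid S indep"
      using matroid.indep_empty[OF M] matroid.indep_subset_ground[OF M]
      unfolding uniform_matroid_def by (intro exI[of _ 0]) (metis card.empty le0 subset_empty)
    then show ?thesis using uniform_straight fin by blast
  next
    case 2
    then show ?thesis
      using less.prems(2)[OF connected_component[OF M]] uniform_straight[OF fin]
      by (simp add: restrict_ground[OF M])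
  next
    case 3
    then obtain S1 S2 indep1 indep2 where ms: "matroid_sum S1 S2 indep1 indep2" and S: "S = S1 \<union> S2"
      and ind: "indep = direct_sum_indep S1 indep1 S2 indep2" and lt: "card S1 < card S" "card S2 < card S"
      using disconnected_sum[OF M] by metis
    interpret matroid_sum S1 S2 indep1 indep2 by (rule ms)
    interpret sw: matroid_sum S2 S1 indep2 indep1 by (rule matroid_sum_commute[OF ms])
    have ind': "indep = direct_sum_indep S2 indep2 S1 indep1" using ind direct_sum_indep_commute by metis
    have "straight indep1"
      using less.hyps[OF lt(1) matroid1] less.prems(2) component_summand restrict_summand
      unfolding S ind is_component_def by metis
    moreover have "straight indep2"
      using less.hyps[OF lt(2) matroid2] less.prems(2) sw.component_summand sw.restrict_summand
      unfolding S ind' Un_commute[of S1] is_component_def by metis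
    ultimately show ?thesis unfolding ind by (rule straight_sum)
  qed
qed

lemma (in matroid_sum) split_summand:
  assumes "split_matroid (S1 \<union> S2) indep"
  shows "split_matroid S1 indep1"
proof -
  have "restrict_indep indep C = restrict_indep indep1 C" "is_component (S1 \<union> S2) indep C"
    if "is_component S1 indep1 C" for C
    using that component_summand restrict_summand by (auto simp: is_component_def)
  then show ?thesis
    using assms matroid1 unfolding split_matroid_def Uniq_def by metis
qed

text \<open>
  When \<open>S\<close> decomposes, at most one of the two summands contains a non-uniform component, because it
  would be the same component in both. So one summand is straight and the other nearly straight.
\<close>

lemma split_nearly_straight:
  assumes "split_matroid S indep"
  shows "nearly_straight indep"
  using assms
proof (induction "card S" arbitrary: S indep rule: less_induct)
  case less
  have M: "matroid S indep" using less.prems by (simp add: split_matroid_def)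
  have fin: "finite S" using M by (rule matroid.finite_ground)
  consider "uniform_matroid S indep \<or> S = {}"
    | "\<not> uniform_matroid S indep" "S \<noteq> {}" "connected_matroid S indep" | "\<not> connected_matroid S indep"
    by blast
  then show ?case
  proof cases
    case 1
    have "straight indep"
      using 1
    proof
      assume "uniform_matroid S indep"
      then show ?thesis using uniform_straight fin by blast
    next
      assume "S = {}"
      then show ?thesis using straight_if_components_uniform[OF M] by (auto simp: is_component_def)
    qed
    then show ?thesis by (auto simp: straight_def nearly_straight_def)
  next
    case 2
    have "elementary_split_matroid S indep"
      using less.prems connected_component[OF M 2(2,3)] 2(1) restrict_ground[OF M]
      unfolding split_matroid_def by metis
    then show ?thesis by (rule elementary_split_nearly_straight)
  next
    case 3
    then obtain S1 S2 indep1 indep2 where ms: "matroid_sum S1 S2 indep1 indep2" and S: "S = S1 \<union> S2"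
      and ind: "indep = direct_sum_indep S1 indep1 S2 indep2" and lt: "card S1 < card S" "card S2 < card S"
      using disconnected_sum[OF M] by metis
    interpret matroid_sum S1 S2 indep1 indep2 by (rule ms)
    interpret sw: matroid_sum S2 S1 indep2 indep1 by (rule matroid_sum_commute[OF ms])
    have ind': "indep = direct_sum_indep S2 indep2 S1 indep1" using ind direct_sum_indep_commute by metis
    have S': "S = S2 \<union> S1" using S by auto
    have near1: "nearly_straight indep1"
      using less.hyps[OF lt(1)] split_summand less.prems unfolding S ind by blast
    have near2: "nearly_straight indep2"
      using less.hyps[OF lt(2)] sw.split_summand less.prems unfolding S' ind' by blast
    show ?thesis
    proof (cases "\<forall>C. is_component S1 indep1 C \<longrightarrow> uniform_matroid C (restrict_indep indep1 C)")
      case True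
      then have "straight indep1" using straight_if_components_uniform[OF matroid1] by blast
      then show ?thesis unfolding ind using near2 by (rule nearly_straight_sum)
    next
      case False
      then obtain C where C: "is_component S1 indep1 C" "\<not> uniform_matroid C (restrict_indep indep1 C)"
        by blast
      have subC: "C \<subseteq> S1" "C \<noteq> {}" using C(1) by (auto simp: is_component_def)
      have C': "is_component S indep C" "\<not> uniform_matroid C (restrict_indep indep C)"
        using component_summand[OF C(1)] C(2) restrict_summand[OF subC(1)] by (auto simp: S ind)
      have "uniform_matroid E (restrict_indep indep2 E)" if E: "is_component S2 indep2 E" for E
      proof (rule ccontr)
        assume n: "\<not> ?thesis"
        have subE: "E \<subseteq> S2" using E by (auto simp: is_component_def)
        have "is_component S indep E" "\<not> uniform_matroid E (restrict_indep indep E)"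
          using sw.component_summand[OF E] n sw.restrict_summand[OF subE] by (auto simp: S' ind')
        then have "E = C" using C' less.prems unfolding split_matroid_def Uniq_def by blast
        then show False using subC subE disjoint by auto
      qed
      then have "straight indep2" using straight_if_components_uniform[OF matroid2] by blast
      then show ?thesis unfolding ind' using near1 by (rule sw.nearly_straight_sum)
    qed
  qed
qed

section \<open>The exchange distance\<close>

lemma card_basis:
  assumes M: "matroid S indep" and B: "is_basis indep B"
  shows "card B = matroid_rank indep"
proof -
  have fin: "finite S" using M by (rule matroid.finite_ground)
  have sub: "{X. indep X} \<subseteq> Pow S" using matroid.indep_subset_ground[OF M] by blast
  have iB: "indep B" and max: "\<And>X. indep X \<Longrightarrow> B \<subseteq> X \<Longrightarrow> X = B" using B by (auto simp: is_basis_def)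
  have "card X \<le> card B" if X: "indep X" for X
  proof (rule ccontr)
    assume "\<not> ?thesis"
    then obtain e where "e \<in> X - B" "indep (insert e B)"
      using matroid.augmentation[OF M iB X] by auto
    then show False using max[of "insert e B"] by auto
  qed
  then show ?thesis
    unfolding matroid_rank_def
    by (intro Max_eqI[symmetric]) (use iB finite_subset[OF sub] fin in auto)
qed

lemma exchange_distance_le:
  "(P, Q) \<in> symmetric_exchange indep ^^ n \<Longrightarrow> n \<le> m \<Longrightarrow> exchange_distance indep P Q \<le> enat m"
  unfolding exchange_distance_def by (rule order_trans[OF Inf_lower, of "enat n"]) auto

theorem theorem7:
  fixes S :: "'a set" and indep :: "'a set \<Rightarrow> bool" and r :: nat
    and A1 A2 B1 B2 :: "'a set"
  assumes "split_matroid S indep"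
    and "matroid_rank indep = r"
    and "is_basis indep A1" and "is_basis indep A2"
    and "is_basis indep B1" and "is_basis indep B2"
    and "compatible_pairs (A1, A2) (B1, B2)"
  shows "exchange_distance indep (A1, A2) (B1, B2) \<le> enat (min r (r - card (A1 \<inter> B1) + 1))"
proof -
  have M: "matroid S indep" using assms(1) by (simp add: split_matroid_def)
  have "A1 \<subseteq> S" using assms(3) matroid.indep_subset_ground[OF M] by (simp add: is_basis_def)
  then have fA: "finite A1" using matroid.finite_ground[OF M] finite_subset by blast
  have r: "card A1 = r" using card_basis[OF M assms(3)] assms(2) by simp
  have k: "card (A1 - B1) = r - card (A1 \<inter> B1)" using fA r by (simp add: card_Diff_subset_Int)
  have le: "card (A1 \<inter> B1) \<le> r" using fA r by (metis card_mono inf_le1)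
  have "compatible_bases indep A1 A2 B1 B2"
    using assms(3-7) by (simp add: compatible_bases_def compatible_pairs_def)
  then consider "((A1, A2), (B1, B2)) \<in> symmetric_exchange indep ^^ card (A1 - B1)"
    | "A1 \<inter> B1 \<noteq> {}" "((A1, A2), (B1, B2)) \<in> symmetric_exchange indep ^^ Suc (card (A1 - B1))"
    using split_nearly_straight[OF assms(1)] unfolding nearly_straight_def by blast
  then show ?thesis
  proof cases
    case 1
    then show ?thesis by (rule exchange_distance_le) (use k in simp)
  next
    case 2
    have "card (A1 \<inter> B1) > 0" using 2(1) fA by (simp add: card_gt_0_iff)
    then show ?thesis by (intro exchange_distance_le[OF 2(2)]) (use k le in simp)
  qed
qed

end
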